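(* For $\lambda\in P^+$ let $t_\lambda\in\tilde W$ be the translation in $\lambda$, let $n_\lambda$ be the maximal length element of the double coset $Wt_\lambda W$, and let $M_\lambda=\mathbf 1_0x^\lambda\mathbf 1_0$. Then, in the affine Hecke algebra $\tilde H$, $$q^{-\ell(w_0)}\,W_0(q^2)\cdot\frac{W_0(q^{-2})}{W_\lambda(q^{-2})}\cdot M_\lambda=\sum_{x\in Wt_\lambda W}q^{\ell(x)-\ell(n_\lambda)}\,T_x .$$
   Context: Root data. $R$ is a reduced irreducible root system spanning a finite-dimensional real vector space with nondegenerate symmetric bilinear form $\langle\,,\rangle$; $\alpha^\vee=2\alpha/\langle\alpha,\alpha\rangle$; $W$ is the Weyl group, $R^+$ a choice of positive roots, $\alpha_1,\dots,\alpha_n$ the simple roots, $s_i=s_{\alpha_i}$, $\ell$ the length function, $w_0$ the longest element of $W$. $P=\{\lambda:\langle\lambda,\alpha^\vee\rangle\in\mathbb Z\ \forall\alpha\in R\}$, $P^+=\{\lambda\in P:\langle\lambda,\alpha^\vee\rangle\ge0\ \forall\alpha\in R^+\}$. For $\mu\in P$, $W_\mu$ is the stabilizer of $\mu$ in $W$ and $W_\mu(t)=\sum_{w\in W_\mu}t^{\ell(w)}$ (so $W_0(t)=\sum_{w\in W}t^{\ell(w)}$). Extended affine Weyl group. $\tilde W=\{wt_\lambda: w\in W,\lambda\in P\}=W\ltimes P$ with $t_\lambda t_\mu=t_{\lambda+\mu}$, $wt_\lambda=t_{w\lambda}w$, and length $\ell(wt_\lambda)=\sum_{\alpha\in R^+}|\langle\lambda,\alpha^\vee\rangle+\chi(w\alpha)|$,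 where $\chi(\beta)=0$ if $\beta\in R^+$ and $1$ if $-\beta\in R^+$. Let $\varphi\in R^+$ be the root whose coroot $\varphi^\vee$ is the highest coroot and $s_0=t_\varphi s_\varphi$ (the reflection in $\{x:\langle x,\varphi^\vee\rangle=1\}$). Affine Hecke algebra. $\mathbb K=\mathbb Z[q,q^{-1}]$ with $W_0(q^2)^{-1}$ adjoined. $\tilde H$ is the $\mathbb K$-algebra with basis $T_w$, $w\in\tilde W$, and relations $T_{w_1}T_{w_2}=T_{w_1w_2}$ if $\ell(w_1w_2)=\ell(w_1)+\ell(w_2)$, and $T_{s_i}T_w=(q-q^{-1})T_w+T_{s_iw}$ if $\ell(s_iw)<\ell(w)$, $0\le i\le n$. For $\lambda\in P$ write $\lambda=\mu-\nu$ with $\mu,\nu\in P^+$ and set $x^\lambda=T_{t_\mu}T_{t_\nu}^{-1}$ (independent of choices). Put $\mathbf 1_0=\frac1{W_0(q^2)}\sum_{w\in W}q^{\ell(w)}T_w$. *)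

theory Defs
  imports "HOL-Analysis.Analysis" "HOL-Computational_Algebra.Polynomial"
    "HOL-Computational_Algebra.Fraction_Field"
begin

section \<open>Root systems\<close>

text \<open>
  The class \<open>euclidean_space\<close> only serves to provide a finite-dimensional real vector space:
  the form of the root system is an arbitrary nondegenerate symmetric bilinear form \<open>B\<close>, not
  assumed definite, and the built-in inner product is not used.
\<close>

definition coroot :: "('a::euclidean_space \<Rightarrow> 'a \<Rightarrow> real) \<Rightarrow> 'a \<Rightarrow> 'a" where
  "coroot B \<alpha> = (2 / B \<alpha> \<alpha>) *\<^sub>R \<alpha>"

definition reflection :: "('a::euclidean_space \<Rightarrow> 'a \<Rightarrow> real) \<Rightarrow> 'a \<Rightarrow> 'a \<Rightarrow> 'a" where
  "reflection B \<alpha> x = x - B x (coroot B \<alpha>) *\<^sub>R \<alpha>"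

definition translation :: "'a::real_vector \<Rightarrow> 'a \<Rightarrow> 'a" where
  "translation lam x = x + lam"

locale root_system =
  fixes B :: "'a::euclidean_space \<Rightarrow> 'a \<Rightarrow> real"
    and R :: "'a set"
  assumes bilinear_form: "bilinear B"
    and symmetric_form: "B x y = B y x"
    and nondegenerate_form: "(\<And>y. B x y = 0) \<Longrightarrow> x = 0"
    and finite_roots: "finite R"
    and span_roots: "span R = UNIV"
    and nonisotropic: "\<alpha> \<in> R \<Longrightarrow> B \<alpha> \<alpha> \<noteq> 0"
    and reflection_roots: "\<alpha> \<in> R \<Longrightarrow> \<beta> \<in> R \<Longrightarrow> reflection B \<alpha> \<beta> \<in> R"
    and integrality: "\<alpha> \<in> R \<Longrightarrow> \<beta> \<in> R \<Longrightarrow> B \<beta> (coroot B \<alpha>) \<in> \<int>"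
    and reduced: "\<alpha> \<in> R \<Longrightarrow> c *\<^sub>R \<alpha> \<in> R \<Longrightarrow> c = 1 \<or> c = -1"
    and irreducible: "R \<noteq> {}"
      "R = R1 \<union> R2 \<Longrightarrow> R1 \<inter> R2 = {} \<Longrightarrow> (\<And>\<alpha> \<beta>. \<alpha> \<in> R1 \<Longrightarrow> \<beta> \<in> R2 \<Longrightarrow> B \<alpha> \<beta> = 0)
        \<Longrightarrow> R1 = {} \<or> R2 = {}"
begin

text \<open>
  The group generated by the reflections. No rule for inverses is needed, because the generators
  are involutions.
\<close>

inductive_set weyl_group :: "('a \<Rightarrow> 'a) set" where
  weyl_id: "id \<in> weyl_group"
| weyl_step: "\<alpha> \<in> R \<Longrightarrow> w \<in> weyl_group \<Longrightarrow> reflection B \<alpha> \<circ> w \<in> weyl_group"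

definition weights :: "'a set" where
  "weights = {lam. \<forall>\<alpha>\<in>R. B lam (coroot B \<alpha>) \<in> \<int>}"

definition stabilizer :: "'a \<Rightarrow> ('a \<Rightarrow> 'a) set" where
  "stabilizer \<mu> = {w \<in> weyl_group. w \<mu> = \<mu>}"

text \<open>
  The extended affine Weyl group, realized faithfully as a group of affine maps of the ambient
  space under composition; \<open>w t\<^sub>\<lambda>\<close> is \<open>w \<circ> translation lam\<close>.
\<close>

definition ext_affine_weyl_group :: "('a \<Rightarrow> 'a) set" where
  "ext_affine_weyl_group = {w \<circ> translation lam | w lam. w \<in> weyl_group \<and> lam \<in> weights}"

definition double_coset :: "'a \<Rightarrow> ('a \<Rightarrow> 'a) set" where
  "double_coset lam = {u \<circ> translation lam \<circ> v | u v. u \<in> weyl_group \<and> v \<in> weyl_group}"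

end

text \<open>
  Positive roots are the roots on one side of a hyperplane through the origin that contains no
  root; simple roots are the positive roots that are not a sum of two positive roots.
\<close>

locale positive_root_system = root_system B R
  for B :: "'a::euclidean_space \<Rightarrow> 'a \<Rightarrow> real" and R :: "'a set" +
  fixes Rp :: "'a set"
  assumes positive_system:
    "\<exists>f :: 'a \<Rightarrow> real. linear f \<and> (\<forall>\<alpha>\<in>R. f \<alpha> \<noteq> 0) \<and> Rp = {\<alpha> \<in> R. f \<alpha> > 0}"
begin

definition simple_roots :: "'a set" where
  "simple_roots = {\<alpha> \<in> Rp. \<not> (\<exists>\<beta>\<in>Rp. \<exists>\<gamma>\<in>Rp. \<alpha> = \<beta> + \<gamma>)}"

definition dominant_weights :: "'a set" where
  "dominant_weights = {lam \<in> weights. \<forall>\<alpha>\<in>Rp. B lam (coroot B \<alpha>) \<ge> 0}"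

definition weyl_length :: "('a \<Rightarrow> 'a) \<Rightarrow> nat" where
  "weyl_length w = (LEAST k. \<exists>\<alpha>s. length \<alpha>s = k \<and> set \<alpha>s \<subseteq> simple_roots \<and>
     w = foldr (\<lambda>\<alpha> u. reflection B \<alpha> \<circ> u) \<alpha>s id)"

definition longest_element :: "'a \<Rightarrow> 'a" where
  "longest_element = (ARG_MAX weyl_length w. w \<in> weyl_group)"

definition poincare :: "'a \<Rightarrow> 'k::comm_ring_1 \<Rightarrow> 'k" where
  "poincare \<mu> t = (\<Sum>w\<in>stabilizer \<mu>. t ^ weyl_length w)"

definition chi :: "'a \<Rightarrow> real" where
  "chi \<beta> = (if \<beta> \<in> Rp then 0 else 1)"

text \<open>
  For \<open>x = w \<circ> translation lam\<close> the linear part is \<open>w v = x v - x 0\<close> and \<open>x 0 = w lam\<close>; the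
  lemma \<open>affine_length_eq\<close> below recovers the usual formula in terms of \<open>w\<close> and \<open>lam\<close>.
  The sum is a nonnegative integer, so \<open>floor\<close> and \<open>nat\<close> only change its type.
\<close>

definition affine_length :: "('a \<Rightarrow> 'a) \<Rightarrow> nat" where
  "affine_length x =
     (let w = (\<lambda>v. x v - x 0); lam = inv w (x 0)
      in nat \<lfloor>\<Sum>\<alpha>\<in>Rp. \<bar>B lam (coroot B \<alpha>) + chi (w \<alpha>)\<bar>\<rfloor>)"

lemma linear_reflection: "linear (reflection B \<alpha>)"
proof -
  have "linear (\<lambda>x. B x (coroot B \<alpha>))"
    using bilinear_form by (simp add: bilinear_def)
  then show ?thesis
    unfolding reflection_def [abs_def]
    by (intro linear_compose_sub linear_ident linear_compose_scale_right linear_scale_left)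
      (auto simp: linear_iff algebra_simps)
qed

lemma reflection_involution: "\<alpha> \<in> R \<Longrightarrow> reflection B \<alpha> (reflection B \<alpha> x) = x"
  using nonisotropic [of \<alpha>] bilinear_form
  by (simp add: reflection_def coroot_def bilinear_lsub bilinear_lmul bilinear_rmul algebra_simps)

lemma weyl_group_linear_bij: "w \<in> weyl_group \<Longrightarrow> linear w \<and> bij w"
proof (induction rule: weyl_group.induct)
  case weyl_id
  then show ?case using linear_id bij_id by (simp add: id_def)
next
  case (weyl_step \<alpha> w)
  have "bij (reflection B \<alpha>)"
    by (rule involuntory_imp_bij) (rule reflection_involution [OF weyl_step(1)])
  then show ?case
    using weyl_step.IH linear_reflection [of \<alpha>]
    by (blast intro: linear_compose bij_comp)
qed

lemma affine_length_eq:
  assumes "w \<in> weyl_group"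
  shows "affine_length (w \<circ> translation lam) =
    nat \<lfloor>\<Sum>\<alpha>\<in>Rp. \<bar>B lam (coroot B \<alpha>) + chi (w \<alpha>)\<bar>\<rfloor>"
proof -
  have lin: "linear w" and "bij w" using weyl_group_linear_bij [OF assms] by auto
  have "(\<lambda>v. (w \<circ> translation lam) v - (w \<circ> translation lam) 0) = w"
    by (auto simp: translation_def linear_add [OF lin])
  moreover have "inv w ((w \<circ> translation lam) 0) = lam"
    using \<open>bij w\<close> by (simp add: translation_def bij_is_inj)
  ultimately show ?thesis by (simp add: affine_length_def Let_def)
qed

definition max_length_element :: "'a \<Rightarrow> 'a \<Rightarrow> 'a" where
  "max_length_element lam = (ARG_MAX affine_length x. x \<in> double_coset lam)"

end

text \<open>\<open>\<phi>\<close> is the positive root whose coroot is the highest coroot.\<close>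

locale affine_root_datum = positive_root_system B R Rp
  for B :: "'a::euclidean_space \<Rightarrow> 'a \<Rightarrow> real" and R Rp :: "'a set" +
  fixes \<phi> :: 'a
  assumes phi_positive: "\<phi> \<in> Rp"
    and phi_highest: "\<alpha> \<in> Rp \<Longrightarrow> \<exists>c :: 'a \<Rightarrow> nat.
      coroot B \<phi> - coroot B \<alpha> = (\<Sum>\<beta>\<in>simple_roots. real (c \<beta>) *\<^sub>R coroot B \<beta>)"
begin

definition s0 :: "'a \<Rightarrow> 'a" where
  "s0 = translation \<phi> \<circ> reflection B \<phi>"

definition simple_reflections :: "('a \<Rightarrow> 'a) set" where
  "simple_reflections = insert s0 (reflection B ` simple_roots)"

end

section \<open>The affine Hecke algebra\<close>

definition hecke_q :: "int poly fract" where
  "hecke_q = Fract [:0, 1:] 1"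

inductive_set subring_generated :: "'k::ring_1 set \<Rightarrow> 'k set" for S where
  gen: "a \<in> S \<Longrightarrow> a \<in> subring_generated S"
| one: "1 \<in> subring_generated S"
| diff: "a \<in> subring_generated S \<Longrightarrow> b \<in> subring_generated S \<Longrightarrow> a - b \<in> subring_generated S"
| mult: "a \<in> subring_generated S \<Longrightarrow> b \<in> subring_generated S \<Longrightarrow> a * b \<in> subring_generated S"

definition ring_inverse :: "'h::ring_1 \<Rightarrow> 'h" where
  "ring_inverse a = (THE b. a * b = 1 \<and> b * a = 1)"

text \<open>The coefficient ring, as a subring of the field of fractions of \<open>\<int>[q]\<close>.\<close>

definition (in positive_root_system) coeff_ring :: "int poly fract set" where
  "coeff_ring = subring_generated
     {hecke_q, inverse hecke_q, inverse (poincare 0 (hecke_q ^ 2))}"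

text \<open>
  \<open>smul\<close> is the action of the coefficient ring on the algebra; nothing is assumed about \<open>smul a\<close>
  for \<open>a\<close> outside \<open>coeff_ring\<close>, nor about \<open>T x\<close> for \<open>x\<close> outside the extended affine Weyl group.
\<close>

locale affine_hecke_algebra = affine_root_datum B R Rp \<phi>
  for B :: "'a::euclidean_space \<Rightarrow> 'a \<Rightarrow> real" and R Rp :: "'a set" and \<phi> :: 'a +
  fixes smul :: "int poly fract \<Rightarrow> 'h::ring_1 \<Rightarrow> 'h"
    and T :: "('a \<Rightarrow> 'a) \<Rightarrow> 'h"
  assumes smul_add_right: "a \<in> coeff_ring \<Longrightarrow> smul a (x + y) = smul a x + smul a y"
    and smul_add_left: "a \<in> coeff_ring \<Longrightarrow> b \<in> coeff_ring \<Longrightarrow> smul (a + b) x = smul a x + smul b x"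
    and smul_smul: "a \<in> coeff_ring \<Longrightarrow> b \<in> coeff_ring \<Longrightarrow> smul (a * b) x = smul a (smul b x)"
    and smul_one: "smul 1 x = x"
    and smul_mult_left: "a \<in> coeff_ring \<Longrightarrow> smul a x * y = smul a (x * y)"
    and smul_mult_right: "a \<in> coeff_ring \<Longrightarrow> x * smul a y = smul a (x * y)"
    and T_basis: "\<exists>!c. finite {w. c w \<noteq> 0} \<and> {w. c w \<noteq> 0} \<subseteq> ext_affine_weyl_group \<and>
      range c \<subseteq> coeff_ring \<and> h = (\<Sum>w | c w \<noteq> 0. smul (c w) (T w))"
    and T_mult: "v \<in> ext_affine_weyl_group \<Longrightarrow> w \<in> ext_affine_weyl_group \<Longrightarrow>
      affine_length (v \<circ> w) = affine_length v + affine_length w \<Longrightarrow> T v * T w = T (v \<circ> w)"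
    and T_quadratic: "s \<in> simple_reflections \<Longrightarrow> w \<in> ext_affine_weyl_group \<Longrightarrow>
      affine_length (s \<circ> w) < affine_length w \<Longrightarrow>
      T s * T w = smul (hecke_q - inverse hecke_q) (T w) + T (s \<circ> w)"
begin

text \<open>\<open>x_elem lam\<close> is \<open>x\<^sup>\<lambda>\<close> for \<open>\<lambda> = lam\<close>; it does not depend on the chosen decomposition of \<open>lam\<close>.\<close>

definition x_elem :: "'a \<Rightarrow> 'h" where
  "x_elem lam =
     (case (SOME (\<mu>, \<nu>). \<mu> \<in> dominant_weights \<and> \<nu> \<in> dominant_weights \<and> lam = \<mu> - \<nu>) of
        (\<mu>, \<nu>) \<Rightarrow> T (translation \<mu>) * ring_inverse (T (translation \<nu>)))"

definition one0 :: 'h where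
  "one0 = smul (1 / poincare 0 (hecke_q ^ 2))
     (\<Sum>w\<in>weyl_group. smul (hecke_q ^ weyl_length w) (T w))"

definition M_elem :: "'a \<Rightarrow> 'h" where
  "M_elem lam = one0 * x_elem lam * one0"

end

end

(*
  Write E for the sum of q^l(w) T_w over W and S for the sum of q^l(x) T_x over the double coset of
  t_lam. Pairing x with s x (or x s) for a simple reflection s shows T_s S = q S = S T_s, hence
  S E = W_0(q^2) S. On the other hand every element of the double coset is uniquely u t_lam v with
  u in W and v a minimal representative of a coset in W_lam \ W, and
  l(u t_lam v) = l(u) + l(t_lam) - l(v). Therefore S E is the sum over v of
  q^l(t_lam v) E T_(t_lam v) E, each term being q^(l(t_lam) - 2 l(v)) E T_(t_lam) E, and the sum of
  q^(-2 l(v)) over v is W_0(q^-2) / W_lam(q^-2).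

  The form B is not assumed definite. Summing products of pairings with the coroots over R gives a
  positive definite form G that every reflection preserves, so the pairing of x with the coroot of a
  is 2 G(x, a) / G(a, a), and the root geometry is carried out with G.
*)
theory Submission
  imports Defs
begin

text \<open>Two demands shape the proof beyond the computation with \<open>E\<close> and
  \<open>S\<close>. \<open>x_elem lam\<close> is a choice: even for dominant \<open>lam\<close> the
  chosen decomposition may be any \<open>\<mu> - \<nu>\<close>, and reading it as
  \<open>T (translation lam)\<close> requires cancelling \<open>T (translation \<nu>)\<close>, hence
  invertibility of basis elements. Peeling off simple reflections reduces that to length 0, provided
  every element of positive length is shortened by some simple reflection on the left; the affine
  reflection \<open>s0\<close> and the highest coroot enter here. Scalars may be moved through
  \<open>smul\<close> only inside \<open>coeff_ring\<close>, whose generators do not list an inverse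
  of \<open>W_lam(q^-2)\<close>, so the quotient of Poincare polynomials has to be rewritten as a
  sum over minimal representatives before it acts. Lengths are treated as half of a sum over all of
  \<open>R\<close>, because Weyl group elements permute \<open>R\<close> but in general not
  \<open>Rp\<close>; length identities can then be checked one root at a time.\<close>

lemma abs_Ints_plus_1: "(x::real) \<in> \<int> \<Longrightarrow> \<bar>x + 1\<bar> = \<bar>x\<bar> + (if x \<ge> 0 then 1 else -1)"
  by (elim Ints_cases) (simp, linarith?)

lemma abs_Ints_minus_1: "(x::real) \<in> \<int> \<Longrightarrow> \<bar>x - 1\<bar> = \<bar>x\<bar> + (if x \<ge> 1 then -1 else 1)"
  by (elim Ints_cases) (simp, linarith?)

section \<open>Nonvanishing of sums of powers of \<open>hecke_q\<close>\<close>

lemma hecke_q_power: "hecke_q ^ n = Fract (monom 1 n) 1"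
proof (induction n)
  case 0
  then show ?case by (simp add: One_fract_def)
next
  case (Suc n)
  then show ?case by (simp add: hecke_q_def monom_Suc)
qed

lemma hecke_q_nonzero [simp]: "hecke_q \<noteq> 0"
  by (simp add: hecke_q_def eq_fract Zero_fract_def)

text \<open>Evaluating the numerator at \<open>1\<close> gives the number of summands.\<close>

lemma sum_hecke_q_power_nonzero:
  assumes "finite S" "S \<noteq> {}"
  shows "(\<Sum>w\<in>S. hecke_q ^ n w) \<noteq> 0"
proof -
  have "(\<Sum>w\<in>S. hecke_q ^ n w) = Fract (\<Sum>w\<in>S. monom 1 (n w)) 1"
    using assms(1) by (induction S) (simp_all add: Zero_fract_def hecke_q_power)
  moreover have "poly (\<Sum>w\<in>S. monom 1 (n w)) (1::int) = int (card S)"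
    by (simp add: poly_sum poly_monom)
  then have "(\<Sum>w\<in>S. monom 1 (n w)) \<noteq> (0 :: int poly)" using assms by auto
  ultimately show ?thesis by (simp add: Zero_fract_def eq_fract)
qed

text \<open>Multiplying by the power of \<open>hecke_q\<close> with the largest exponent leaves only
  nonnegative exponents. This covers the Poincare polynomial at \<open>q^-2\<close> in the
  denominator of the final formula.\<close>

lemma sum_hecke_q_inverse_power_nonzero:
  assumes "finite S" "S \<noteq> {}"
  shows "(\<Sum>w\<in>S. inverse hecke_q ^ n w) \<noteq> 0"
proof -
  let ?m = "Max (n ` S)"
  have "hecke_q ^ ?m * (\<Sum>w\<in>S. inverse hecke_q ^ n w) = (\<Sum>w\<in>S. hecke_q ^ (?m - n w))"
    unfolding sum_distrib_left
  proof (rule sum.cong [OF refl])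
    fix w assume "w \<in> S"
    then have "n w \<le> ?m" using assms by simp
    then show "hecke_q ^ ?m * inverse hecke_q ^ n w = hecke_q ^ (?m - n w)"
      by (simp add: power_diff field_simps)
  qed
  then show ?thesis using sum_hecke_q_power_nonzero [OF assms] by auto
qed

context positive_root_system
begin

section \<open>The invariant form\<close>

definition pairing :: "'a \<Rightarrow> 'a \<Rightarrow> real" where
  "pairing x \<alpha> = B x (coroot B \<alpha>)"

definition inv_form :: "'a \<Rightarrow> 'a \<Rightarrow> real" where
  "inv_form x y = (\<Sum>\<alpha>\<in>R. pairing x \<alpha> * pairing y \<alpha>)"

lemma linear_pairing: "linear (\<lambda>x. pairing x \<alpha>)"
  using bilinear_form by (simp add: pairing_def bilinear_def)

lemmas pairing_add = linear_add [OF linear_pairing]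
  and pairing_diff = linear_diff [OF linear_pairing]
  and pairing_scale = linear_scale [OF linear_pairing]
  and pairing_neg = linear_neg [OF linear_pairing]
  and pairing_0 = linear_0 [OF linear_pairing]

lemma reflection_pairing: "reflection B \<alpha> x = x - pairing x \<alpha> *\<^sub>R \<alpha>"
  by (simp add: reflection_def pairing_def)

lemma pairing_self: "\<alpha> \<in> R \<Longrightarrow> pairing \<alpha> \<alpha> = 2"
  using nonisotropic [of \<alpha>] bilinear_form
  by (simp add: pairing_def coroot_def bilinear_rmul)

lemma reflection_self: "\<alpha> \<in> R \<Longrightarrow> reflection B \<alpha> \<alpha> = - \<alpha>"
  by (simp add: reflection_pairing pairing_self scaleR_2)

lemma uminus_root: "\<alpha> \<in> R \<Longrightarrow> - \<alpha> \<in> R"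
  using reflection_roots [of \<alpha> \<alpha>] by (simp add: reflection_self)

lemma uminus_root_iff [simp]: "- \<alpha> \<in> R \<longleftrightarrow> \<alpha> \<in> R"
  using uminus_root [of \<alpha>] uminus_root [of "- \<alpha>"] by auto

lemma root_nonzero: "\<alpha> \<in> R \<Longrightarrow> \<alpha> \<noteq> 0"
  using nonisotropic [of \<alpha>] bilinear_form by (auto simp: bilinear_lzero)

lemma pairing_uminus_right: "pairing x (- \<alpha>) = - pairing x \<alpha>"
  using bilinear_form
  by (simp add: pairing_def coroot_def bilinear_rmul bilinear_rneg bilinear_lneg)

lemma form_reflection:
  assumes "\<alpha> \<in> R"
  shows "B (reflection B \<alpha> x) (reflection B \<alpha> y) = B x y"
  using nonisotropic [OF assms] bilinear_form symmetric_form [of \<alpha> x] symmetric_form [of \<alpha> y]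
  by (simp add: reflection_def coroot_def bilinear_lsub bilinear_rsub bilinear_lmul bilinear_rmul
      field_simps)

lemma weyl_linear: "w \<in> weyl_group \<Longrightarrow> linear w"
  and weyl_bij: "w \<in> weyl_group \<Longrightarrow> bij w"
  using weyl_group_linear_bij by auto

lemma weyl_form: "w \<in> weyl_group \<Longrightarrow> B (w x) (w y) = B x y"
  by (induction arbitrary: x y rule: weyl_group.induct) (simp_all add: form_reflection)

lemma weyl_root: "w \<in> weyl_group \<Longrightarrow> \<alpha> \<in> R \<Longrightarrow> w \<alpha> \<in> R"
  by (induction arbitrary: \<alpha> rule: weyl_group.induct) (simp_all add: reflection_roots)

lemma weyl_pairing:
  assumes w: "w \<in> weyl_group"
  shows "pairing (w x) (w \<alpha>) = pairing x \<alpha>"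
  using bilinear_form
  by (simp add: pairing_def coroot_def weyl_form [OF w] bilinear_rmul)

lemma weyl_neg: "w \<in> weyl_group \<Longrightarrow> w (- x) = - w x"
  using weyl_linear linear_neg by blast

lemma weyl_inj: "w \<in> weyl_group \<Longrightarrow> inj w"
  using weyl_bij bij_is_inj by blast

lemma weyl_bij_betw_roots:
  assumes "w \<in> weyl_group" shows "bij_betw w R R"
proof -
  have "inj_on w R" using weyl_inj [OF assms] by (rule inj_on_subset) simp
  moreover have "w ` R \<subseteq> R" using weyl_root [OF assms] by auto
  ultimately show ?thesis
    using finite_roots by (simp add: bij_betw_def endo_inj_surj)
qed

lemma reflection_in_weyl: "\<alpha> \<in> R \<Longrightarrow> reflection B \<alpha> \<in> weyl_group"
  using weyl_step [OF _ weyl_id, of \<alpha>] by simp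

lemma weyl_comp: "u \<in> weyl_group \<Longrightarrow> v \<in> weyl_group \<Longrightarrow> u \<circ> v \<in> weyl_group"
  by (induction rule: weyl_group.induct) (simp_all add: comp_assoc weyl_step)

lemma reflection_comp_self: "\<alpha> \<in> R \<Longrightarrow> reflection B \<alpha> \<circ> reflection B \<alpha> = id"
  by (simp add: fun_eq_iff reflection_involution)

lemma inv_reflection: "\<alpha> \<in> R \<Longrightarrow> inv (reflection B \<alpha>) = reflection B \<alpha>"
  by (rule inv_unique_comp) (simp_all add: reflection_comp_self)

lemma weyl_inv: "w \<in> weyl_group \<Longrightarrow> inv w \<in> weyl_group"
proof (induction rule: weyl_group.induct)
  case weyl_id
  show ?case using weyl_group.weyl_id by (simp only: inv_id)
next
  case (weyl_step \<alpha> w)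
  have "inv (reflection B \<alpha> \<circ> w) = inv w \<circ> reflection B \<alpha>"
    using weyl_bij [OF weyl_step(2)] weyl_bij [OF reflection_in_weyl [OF weyl_step(1)]]
    by (simp add: o_inv_distrib inv_reflection [OF weyl_step(1)])
  moreover have "inv w \<circ> reflection B \<alpha> \<in> weyl_group"
    by (rule weyl_comp [OF weyl_step.IH reflection_in_weyl [OF weyl_step(1)]])
  ultimately show ?case by (simp only:)
qed

lemma weyl_inv_f: "w \<in> weyl_group \<Longrightarrow> inv w (w x) = x"
  by (simp add: weyl_inj)

lemma weyl_f_inv: "w \<in> weyl_group \<Longrightarrow> w (inv w x) = x"
  using weyl_bij bij_is_surj surj_f_inv_f by metis

lemmas weyl_cancel = weyl_inv_f weyl_f_inv

lemma weyl_inv_inv [simp]: "w \<in> weyl_group \<Longrightarrow> inv (inv w) = w"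
  using weyl_bij inv_inv_eq by blast

lemma pairing_inv_weyl: "w \<in> weyl_group \<Longrightarrow> pairing (inv w x) \<alpha> = pairing x (w \<alpha>)"
  using weyl_pairing [of w "inv w x" \<alpha>] by (simp add: weyl_cancel)

lemma pairing_weyl: "w \<in> weyl_group \<Longrightarrow> pairing (w x) \<alpha> = pairing x (inv w \<alpha>)"
  using weyl_pairing [of w x "inv w \<alpha>"] by (simp add: weyl_cancel)

text \<open>The roots span, so a Weyl group element is determined by its restriction to
  \<open>R\<close>, and there are finitely many maps from \<open>R\<close> to
  \<open>R\<close>.\<close>

lemma finite_weyl: "finite weyl_group"
proof -
  have "inj_on (\<lambda>w. restrict w R) weyl_group"
  proof (rule inj_onI)
    fix u v assume uv: "u \<in> weyl_group" "v \<in> weyl_group" "restrict u R = restrict v R"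
    then have "u x = v x" if "x \<in> R" for x using that by (metis restrict_apply')
    then have "u x = v x" for x
      using linear_eq_on_span [OF weyl_linear [OF uv(1)] weyl_linear [OF uv(2)], of R x] span_roots
      by simp
    then show "u = v" by (rule ext)
  qed
  moreover have "(\<lambda>w. restrict w R) ` weyl_group \<subseteq> R \<rightarrow>\<^sub>E R"
    using weyl_root by auto
  moreover have "finite (R \<rightarrow>\<^sub>E R)" using finite_roots by (simp add: finite_PiE)
  ultimately show ?thesis using finite_subset finite_imageD by blast
qed

lemma conjugate_reflection:
  assumes "w \<in> weyl_group"
  shows "reflection B (w \<alpha>) (w x) = w (reflection B \<alpha> x)"
  using weyl_linear [OF assms]
  by (simp add: reflection_pairing weyl_pairing [OF assms] linear_diff linear_scale)

lemma inv_form_sym: "inv_form x y = inv_form y x"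
  by (simp add: inv_form_def mult.commute)

lemma linear_inv_form: "linear (\<lambda>x. inv_form x y)"
  unfolding inv_form_def
  by (rule linear_compose_sum)
    (auto simp: linear_iff pairing_add pairing_scale algebra_simps)

lemmas inv_form_add = linear_add [OF linear_inv_form]
  and inv_form_diff = linear_diff [OF linear_inv_form]
  and inv_form_scale = linear_scale [OF linear_inv_form]
  and inv_form_neg = linear_neg [OF linear_inv_form]

lemma inv_form_diff_right: "inv_form x (y - z) = inv_form x y - inv_form x z"
  and inv_form_add_right: "inv_form x (y + z) = inv_form x y + inv_form x z"
  and inv_form_neg_right: "inv_form x (- y) = - inv_form x y"
  and inv_form_scale_right: "inv_form x (c *\<^sub>R y) = c * inv_form x y"
  by (simp_all add: inv_form_sym [of x] inv_form_add inv_form_diff inv_form_neg inv_form_scale)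

text \<open>\<open>w\<close> permutes \<open>R\<close> and preserves \<open>pairing\<close>, so
  reindexing the defining sum by \<open>w\<close> removes it from both arguments.\<close>

lemma inv_form_weyl:
  assumes "w \<in> weyl_group"
  shows "inv_form (w x) (w y) = inv_form x y"
  unfolding inv_form_def
  using sum.reindex_bij_betw [OF weyl_bij_betw_roots [OF assms],
      of "\<lambda>\<alpha>. pairing (w x) \<alpha> * pairing (w y) \<alpha>"]
  by (simp add: weyl_pairing [OF assms])

lemma inv_form_nonneg: "inv_form x x \<ge> 0"
  by (simp add: inv_form_def sum_nonneg)

text \<open>Each coroot is a nonzero multiple of its root, so vanishing pairings make
  \<open>B x\<close> vanish on the spanning set \<open>R\<close>, and \<open>B\<close> is
  nondegenerate. This is what makes \<open>inv_form\<close> definite.\<close>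

lemma pairing_eq_0_imp:
  assumes "\<And>\<alpha>. \<alpha> \<in> R \<Longrightarrow> pairing x \<alpha> = 0"
  shows "x = 0"
proof (rule nondegenerate_form)
  fix y
  have lin: "linear (B x)" using bilinear_form by (simp add: bilinear_def)
  have "B x \<alpha> = 0" if "\<alpha> \<in> R" for \<alpha>
    using assms [OF that] nonisotropic [OF that] bilinear_form
    by (simp add: pairing_def coroot_def bilinear_rmul)
  then show "B x y = 0"
    using linear_eq_0_on_span [OF lin, of R y] span_roots by auto
qed

lemma inv_form_eq_0 [simp]: "inv_form x x = 0 \<longleftrightarrow> x = 0"
proof
  assume "inv_form x x = 0"
  then have "\<forall>\<alpha>\<in>R. pairing x \<alpha> * pairing x \<alpha> = 0"
    unfolding inv_form_def using finite_roots by (subst (asm) sum_nonneg_eq_0_iff) auto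
  then show "x = 0" by (intro pairing_eq_0_imp) auto
qed (simp add: inv_form_def pairing_0)

lemma inv_form_pos: "x \<noteq> 0 \<Longrightarrow> inv_form x x > 0"
  using inv_form_nonneg [of x] inv_form_eq_0 [of x] by linarith

lemma inv_form_root_pos: "\<alpha> \<in> R \<Longrightarrow> inv_form \<alpha> \<alpha> > 0"
  using inv_form_pos root_nonzero by blast

text \<open>Invariance under the reflection in \<alpha>, evaluated at the pair
  \<open>(x, \<alpha>)\<close> and combined with \<alpha> being sent to \<open>- \<alpha>\<close>,
  already determines the pairing.\<close>

lemma inv_form_pairing:
  assumes "\<alpha> \<in> R"
  shows "pairing x \<alpha> * inv_form \<alpha> \<alpha> = 2 * inv_form x \<alpha>"
proof -
  let ?s = "reflection B \<alpha>"
  have "inv_form (?s x) (?s \<alpha>) = inv_form x \<alpha>"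
    by (rule inv_form_weyl [OF reflection_in_weyl [OF assms]])
  then have "inv_form (x - pairing x \<alpha> *\<^sub>R \<alpha>) (- \<alpha>) = inv_form x \<alpha>"
    by (simp add: reflection_self [OF assms] reflection_pairing [of \<alpha> x])
  moreover have "inv_form (x - pairing x \<alpha> *\<^sub>R \<alpha>) (- \<alpha>)
      = - (inv_form x \<alpha> - pairing x \<alpha> * inv_form \<alpha> \<alpha>)"
    by (simp add: inv_form_neg_right inv_form_diff inv_form_scale)
  ultimately show ?thesis by linarith
qed

lemma pairing_eq:
  assumes "\<alpha> \<in> R"
  shows "pairing x \<alpha> = 2 * inv_form x \<alpha> / inv_form \<alpha> \<alpha>"
  using inv_form_pairing [OF assms, of x] inv_form_root_pos [OF assms] root_nonzero [OF assms]
  by (simp add: eq_divide_eq)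

lemma pairing_root_int: "\<alpha> \<in> R \<Longrightarrow> \<beta> \<in> R \<Longrightarrow> pairing \<beta> \<alpha> \<in> \<int>"
  using integrality by (simp add: pairing_def)

lemma inv_form_Cauchy_Schwarz:
  assumes "\<And>c. x \<noteq> c *\<^sub>R y" and "y \<noteq> 0"
  shows "inv_form x y * inv_form x y < inv_form x x * inv_form y y"
proof -
  \<comment> \<open>The coefficient of the orthogonal projection of \<open>x\<close> onto the line
    of \<open>y\<close>.\<close>
  define c where "c = inv_form x y / inv_form y y"
  have yy: "inv_form y y > 0" using inv_form_pos assms by blast
  have "0 < inv_form (x - c *\<^sub>R y) (x - c *\<^sub>R y)"
    using assms(1) [of c] by (intro inv_form_pos) auto
  also have "\<dots> = inv_form x x - inv_form x y * inv_form x y / inv_form y y"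
    using yy
    by (simp add: inv_form_diff inv_form_diff_right inv_form_scale inv_form_scale_right
        inv_form_sym [of y x] c_def field_simps)
  finally show ?thesis using yy by (simp add: field_simps)
qed

text \<open>Reducedness rules out proportional roots, so Cauchy-Schwarz is strict and the product of
  the two pairings is below 4. Both are positive integers, hence one of them is 1, and the
  corresponding reflection produces the difference up to sign.\<close>

lemma root_diff:
  assumes a: "\<alpha> \<in> R" and b: "\<beta> \<in> R" and ne: "\<beta> \<noteq> \<alpha>" and pos: "pairing \<beta> \<alpha> > 0"
  shows "\<beta> - \<alpha> \<in> R"
proof -
  have "\<beta> \<noteq> c *\<^sub>R \<alpha>" for c
  proof
    assume c: "\<beta> = c *\<^sub>R \<alpha>"
    have "c = 1 \<or> c = -1" using reduced [OF a, of c] b by (simp only: c)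
    then show False
    proof
      assume "c = 1"
      then show False using ne c by simp
    next
      assume "c = -1"
      then have "\<beta> = - \<alpha>" using c by simp
      then show False using pos by (simp add: pairing_self [OF a] pairing_neg)
    qed
  qed
  then have CS: "inv_form \<beta> \<alpha> * inv_form \<beta> \<alpha> < inv_form \<beta> \<beta> * inv_form \<alpha> \<alpha>"
    using inv_form_Cauchy_Schwarz root_nonzero [OF a] by blast
  have aa: "inv_form \<alpha> \<alpha> > 0" and bb: "inv_form \<beta> \<beta> > 0"
    using inv_form_root_pos a b by auto
  obtain m where m: "pairing \<beta> \<alpha> = of_int m"
    using pairing_root_int [OF a b] by (auto elim: Ints_cases)
  obtain n where n: "pairing \<alpha> \<beta> = of_int n"
    using pairing_root_int [OF b a] by (auto elim: Ints_cases)
  have bapos: "inv_form \<beta> \<alpha> > 0"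
    using pos aa pairing_eq [OF a, of \<beta>] by (simp add: zero_less_divide_iff)
  then have "pairing \<alpha> \<beta> > 0"
    using bb by (simp add: pairing_eq [OF b] inv_form_sym)
  then have "n > 0" "m > 0" using m n pos by auto
  have "real_of_int (m * n) = 4 * (inv_form \<beta> \<alpha> * inv_form \<beta> \<alpha>) / (inv_form \<beta> \<beta> * inv_form \<alpha> \<alpha>)"
    unfolding of_int_mult m [symmetric] n [symmetric] pairing_eq [OF a] pairing_eq [OF b]
      inv_form_sym [of \<alpha> \<beta>] by simp
  also have "\<dots> < 4" using CS aa bb by (simp add: divide_less_eq)
  finally have mn: "m * n < 4" by linarith
  have "m = 1 \<or> n = 1"
  proof (rule ccontr)
    assume "\<not> ?thesis"
    then have "m \<ge> 2" "n \<ge> 2" using \<open>m > 0\<close> \<open>n > 0\<close> by auto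
    then have "2 * 2 \<le> m * n" by (intro mult_mono) auto
    then show False using mn by simp
  qed
  then show ?thesis
  proof
    assume "m = 1"
    then show ?thesis using reflection_roots [OF a b] m by (simp add: reflection_pairing)
  next
    assume "n = 1"
    then have "\<alpha> - \<beta> \<in> R" using reflection_roots [OF b a] n by (simp add: reflection_pairing)
    then show ?thesis using uminus_root by fastforce
  qed
qed

section \<open>Positive roots and length\<close>

text \<open>Some functional that cuts out the positive system. It serves as a height, but it is
  real-valued and depends on a choice; it is not the sum of coefficients in the simple
  roots.\<close>

definition ht :: "'a \<Rightarrow> real" where
  "ht = (SOME f. linear f \<and> (\<forall>\<alpha>\<in>R. f \<alpha> \<noteq> 0) \<and> Rp = {\<alpha> \<in> R. f \<alpha> > 0})"

lemma ht_props: "linear ht \<and> (\<forall>\<alpha>\<in>R. ht \<alpha> \<noteq> 0) \<and> Rp = {\<alpha> \<in> R. ht \<alpha> > 0}"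
  unfolding ht_def by (rule someI_ex [OF positive_system])

lemma linear_ht: "linear ht"
  using ht_props by blast

lemmas ht_add = linear_add [OF linear_ht]
  and ht_diff = linear_diff [OF linear_ht]
  and ht_scale = linear_scale [OF linear_ht]
  and ht_neg = linear_neg [OF linear_ht]

lemma pos_iff: "\<alpha> \<in> Rp \<longleftrightarrow> \<alpha> \<in> R \<and> ht \<alpha> > 0"
  using ht_props by auto

lemma pos_root: "\<alpha> \<in> Rp \<Longrightarrow> \<alpha> \<in> R"
  by (simp add: pos_iff)

lemma pos_uminus: "\<alpha> \<in> R \<Longrightarrow> - \<alpha> \<in> Rp \<longleftrightarrow> \<alpha> \<notin> Rp"
  using ht_props by (force simp: pos_iff ht_neg)

lemma finite_pos: "finite Rp"
  using finite_subset [OF _ finite_roots, of Rp] pos_root by blast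

lemma simple_pos: "\<alpha> \<in> simple_roots \<Longrightarrow> \<alpha> \<in> Rp"
  by (simp add: simple_roots_def)

lemma simple_root: "\<alpha> \<in> simple_roots \<Longrightarrow> \<alpha> \<in> R"
  by (simp add: simple_pos pos_root)

lemma chi_pos: "\<alpha> \<in> Rp \<Longrightarrow> chi \<alpha> = 0"
  and chi_not_pos: "\<alpha> \<notin> Rp \<Longrightarrow> chi \<alpha> = 1"
  by (simp_all add: chi_def)

lemma chi_cases: "chi \<alpha> = 0 \<or> chi \<alpha> = 1"
  by (simp add: chi_def)

lemma chi_uminus: "\<alpha> \<in> R \<Longrightarrow> chi (- \<alpha>) = 1 - chi \<alpha>"
  by (simp add: chi_def pos_uminus)

section \<open>Induction over positive roots and the action of simple reflections\<close>

text \<open>The values of \<open>ht\<close> are real, so well-foundedness comes from finiteness: the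
  measure is the number of positive roots of smaller \<open>ht\<close>.\<close>

lemma ht_induct [consumes 1, case_names less]:
  assumes "\<alpha> \<in> Rp"
    and step: "\<And>\<alpha>. \<alpha> \<in> Rp \<Longrightarrow> (\<And>\<beta>. \<beta> \<in> Rp \<Longrightarrow> ht \<beta> < ht \<alpha> \<Longrightarrow> P \<beta>) \<Longrightarrow> P \<alpha>"
  shows "P \<alpha>"
  using assms(1)
proof (induction "card {\<beta> \<in> Rp. ht \<beta> < ht \<alpha>}" arbitrary: \<alpha> rule: less_induct)
  case less
  show ?case
  proof (rule step [OF less.prems])
    fix \<beta> assume \<beta>: "\<beta> \<in> Rp" "ht \<beta> < ht \<alpha>"
    have "{\<gamma> \<in> Rp. ht \<gamma> < ht \<beta>} \<subset> {\<gamma> \<in> Rp. ht \<gamma> < ht \<alpha>}" using \<beta> by force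
    then show "P \<beta>" by (intro less.hyps psubset_card_mono \<beta>) (simp add: finite_pos)
  qed
qed

text \<open>Replaces expansions in simple roots with nonnegative coefficients: a positive root that
  is not simple splits into two positive roots, each of smaller \<open>ht\<close>.\<close>

lemma pos_induct [consumes 1, case_names simple add]:
  assumes "\<alpha> \<in> Rp"
    and simple: "\<And>\<alpha>. \<alpha> \<in> simple_roots \<Longrightarrow> P \<alpha>"
    and add: "\<And>\<beta> \<gamma>. \<beta> \<in> Rp \<Longrightarrow> \<gamma> \<in> Rp \<Longrightarrow> \<beta> + \<gamma> \<in> Rp \<Longrightarrow> P \<beta> \<Longrightarrow> P \<gamma> \<Longrightarrow> P (\<beta> + \<gamma>)"
  shows "P \<alpha>"
  using assms(1)
proof (induction rule: ht_induct)
  case (less \<alpha>)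
  show ?case
  proof (cases "\<alpha> \<in> simple_roots")
    case False
    then obtain \<beta> \<gamma> where bg: "\<beta> \<in> Rp" "\<gamma> \<in> Rp" "\<alpha> = \<beta> + \<gamma>"
      using less.hyps by (auto simp: simple_roots_def)
    then have "ht \<beta> < ht \<alpha>" "ht \<gamma> < ht \<alpha>" by (auto simp: ht_add pos_iff)
    then show ?thesis using bg less add by auto
  qed (rule simple)
qed

text \<open>
  The usual argument via linear independence of the simple roots is avoided: if \<open>s\<^sub>\<alpha>\<close> made a
  positive root \<open>\<beta> \<noteq> \<alpha>\<close> negative, then \<open>\<beta>\<close> and \<open>- s\<^sub>\<alpha> \<beta>\<close> would sum to a multiple of \<open>\<alpha>\<close>.
\<close>

lemma pos_sum_not_multiple_simple:
  assumes a: "\<alpha> \<in> simple_roots"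
  shows "\<beta> \<in> Rp \<Longrightarrow> \<gamma> \<in> Rp \<Longrightarrow> \<beta> \<noteq> \<alpha> \<Longrightarrow> \<gamma> \<noteq> \<alpha> \<Longrightarrow> \<beta> + \<gamma> \<noteq> real n *\<^sub>R \<alpha>"
proof (induction n arbitrary: \<beta> \<gamma>)
  case 0
  then have "ht (\<beta> + \<gamma>) > 0" by (simp add: ht_add pos_iff)
  then show ?case using linear_0 [OF linear_ht] by auto
next
  case (Suc n)
  have aR: "\<alpha> \<in> R" using simple_root [OF a] .
  \<comment> \<open>The induction step: subtract \<alpha> from a summand that pairs positively with
    it. The difference is a root; it is positive, since otherwise \<alpha> would be the sum of the
    positive roots \<beta> and \<open>\<alpha> - \<beta>\<close>. It differs from \<alpha> because
    twice a root is not a root, so the induction hypothesis applies to the multiple lowered by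
    one.\<close>
  have *: False
    if b: "\<beta> \<in> Rp" and c: "\<gamma> \<in> Rp" and ne: "\<beta> \<noteq> \<alpha>" "\<gamma> \<noteq> \<alpha>"
      and eq: "\<beta> + \<gamma> = real (Suc n) *\<^sub>R \<alpha>" and p: "pairing \<beta> \<alpha> > 0" for \<beta> \<gamma>
  proof -
    have d: "\<beta> - \<alpha> \<in> R" using root_diff [OF aR pos_root [OF b] ne(1) p] .
    have dp: "\<beta> - \<alpha> \<in> Rp"
    proof (rule ccontr)
      assume "\<beta> - \<alpha> \<notin> Rp"
      then have "\<alpha> - \<beta> \<in> Rp" using pos_uminus [OF d] by simp
      then have "\<exists>\<beta>\<in>Rp. \<exists>\<gamma>\<in>Rp. \<alpha> = \<beta> + \<gamma>" using b by (intro bexI [of _ \<beta>] bexI [of _ "\<alpha> - \<beta>"]) auto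
      then show False using a by (simp add: simple_roots_def)
    qed
    have "\<beta> - \<alpha> \<noteq> \<alpha>"
    proof
      assume "\<beta> - \<alpha> = \<alpha>"
      then have "2 *\<^sub>R \<alpha> \<in> R" using pos_root [OF b] by (simp add: scaleR_2 algebra_simps)
      then show False using reduced [OF aR, of 2] by simp
    qed
    moreover have "(\<beta> - \<alpha>) + \<gamma> = real n *\<^sub>R \<alpha>" using eq by (simp add: algebra_simps)
    ultimately show False using Suc.IH [OF dp c _ ne(2)] by blast
  qed
  show ?case
  proof
    assume eq: "\<beta> + \<gamma> = real (Suc n) *\<^sub>R \<alpha>"
    then have "pairing \<beta> \<alpha> + pairing \<gamma> \<alpha> = real (Suc n) * 2"
      using pairing_add [of \<beta> \<gamma> \<alpha>] by (simp only: pairing_scale pairing_self [OF aR] real_scaleR_def)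
    then have "pairing \<beta> \<alpha> + pairing \<gamma> \<alpha> > 0" by simp
    then have "pairing \<beta> \<alpha> > 0 \<or> pairing \<gamma> \<alpha> > 0" by linarith
    moreover have "\<gamma> + \<beta> = real (Suc n) *\<^sub>R \<alpha>" using eq by (simp only: add.commute)
    ultimately show False using * Suc.prems eq by blast
  qed
qed

lemma simple_reflection_pos:
  assumes a: "\<alpha> \<in> simple_roots" and b: "\<beta> \<in> Rp" and ne: "\<beta> \<noteq> \<alpha>"
  shows "reflection B \<alpha> \<beta> \<in> Rp"
proof (rule ccontr)
  assume neg: "reflection B \<alpha> \<beta> \<notin> Rp"
  have aR: "\<alpha> \<in> R" and bR: "\<beta> \<in> R" using simple_root [OF a] pos_root [OF b] .
  let ?c = "- reflection B \<alpha> \<beta>"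
  have c: "?c \<in> Rp" using neg pos_uminus reflection_roots [OF aR bR] by blast
  obtain m where m: "pairing \<beta> \<alpha> = of_int m"
    using pairing_root_int [OF aR bR] by (auto elim: Ints_cases)
  have sum: "\<beta> + ?c = pairing \<beta> \<alpha> *\<^sub>R \<alpha>" by (simp add: reflection_pairing)
  have "ht (\<beta> + ?c) > 0" using b c ht_add [of \<beta> ?c] unfolding pos_iff by linarith
  then have "pairing \<beta> \<alpha> * ht \<alpha> > 0" unfolding sum by (simp add: ht_scale)
  then have "m > 0" using simple_pos [OF a] by (simp add: pos_iff m zero_less_mult_iff)
  then have "\<beta> + ?c = real (nat m) *\<^sub>R \<alpha>" using sum m by simp
  moreover have "?c \<noteq> \<alpha>"
  proof
    assume "?c = \<alpha>"
    then have "reflection B \<alpha> (reflection B \<alpha> \<beta>) = - reflection B \<alpha> \<alpha>"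
      using weyl_neg [OF reflection_in_weyl [OF aR], of \<alpha>] by (simp add: minus_equation_iff)
    then show False using ne by (simp add: reflection_involution [OF aR] reflection_self [OF aR])
  qed
  ultimately show False using pos_sum_not_multiple_simple [OF a b c ne] by blast
qed

lemma chi_simple_reflection:
  assumes a: "\<alpha> \<in> simple_roots" and b: "\<beta> \<in> R" "\<beta> \<noteq> \<alpha>" "\<beta> \<noteq> - \<alpha>"
  shows "chi (reflection B \<alpha> \<beta>) = chi \<beta>"
proof (cases "\<beta> \<in> Rp")
  case True
  then show ?thesis using simple_reflection_pos [OF a True b(2)] by (simp add: chi_pos)
next
  case False
  then have "- \<beta> \<in> Rp" using pos_uminus [OF b(1)] by simp
  moreover have "- \<beta> \<noteq> \<alpha>" using b by auto
  ultimately have "reflection B \<alpha> (- \<beta>) \<in> Rp" by (rule simple_reflection_pos [OF a])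
  then have "- reflection B \<alpha> \<beta> \<in> Rp"
    using weyl_neg [OF reflection_in_weyl [OF simple_root [OF a]]] by simp
  then have "reflection B \<alpha> \<beta> \<notin> Rp"
    using pos_uminus reflection_roots [OF simple_root [OF a] b(1)] by blast
  then show ?thesis using False by (simp add: chi_not_pos)
qed

section \<open>The length as a sum over all roots\<close>

lemma sum_roots_even:
  fixes g :: "'a \<Rightarrow> real"
  assumes "\<And>\<alpha>. \<alpha> \<in> R \<Longrightarrow> g (- \<alpha>) = g \<alpha>"
  shows "sum g R = 2 * sum g Rp"
proof -
  have R: "R = Rp \<union> uminus ` Rp"
    using pos_root pos_uminus by (force simp: image_iff)
  have "Rp \<inter> uminus ` Rp = {}" using pos_root pos_uminus by auto
  then have "sum g R = sum g Rp + sum g (uminus ` Rp)"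
    using finite_pos by (subst R) (simp add: sum.union_disjoint)
  also have "sum g (uminus ` Rp) = sum g Rp"
    using assms pos_root by (subst sum.reindex) (auto intro!: sum.cong)
  finally show ?thesis by simp
qed

text \<open>Multiplication by a simple reflection alters the length summand at a single pair of
  opposite roots. Evenness makes both contribute equally, and the factor 2 cancels against the
  halving in \<open>real_affine_length\<close>.\<close>

lemma sum_roots_change:
  fixes g g' :: "'a \<Rightarrow> real"
  assumes \<gamma>: "\<gamma> \<in> R"
    and even: "g (- \<gamma>) = g \<gamma>" "g' (- \<gamma>) = g' \<gamma>"
    and same: "\<And>\<beta>. \<beta> \<in> R \<Longrightarrow> \<beta> \<noteq> \<gamma> \<Longrightarrow> \<beta> \<noteq> - \<gamma> \<Longrightarrow> g' \<beta> = g \<beta>"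
  shows "sum g' R = sum g R + 2 * (g' \<gamma> - g \<gamma>)"
proof -
  have ne: "\<gamma> \<noteq> - \<gamma>"
    using root_nonzero [OF \<gamma>] by (metis add_eq_0_iff scaleR_2 scaleR_eq_0_iff zero_neq_numeral)
  have split: "sum h R = h \<gamma> + h (- \<gamma>) + sum h (R - {\<gamma>, - \<gamma>})" for h :: "'a \<Rightarrow> real"
  proof -
    have "sum h R = sum h {\<gamma>, - \<gamma>} + sum h (R - {\<gamma>, - \<gamma>})"
      using sum.subset_diff [OF _ finite_roots, of "{\<gamma>, - \<gamma>}" h] \<gamma> by (simp add: add.commute)
    then show ?thesis using ne by simp
  qed
  have "sum g' (R - {\<gamma>, - \<gamma>}) = sum g (R - {\<gamma>, - \<gamma>})"
    using same by (intro sum.cong) auto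
  then show ?thesis using even by (simp add: split [of g] split [of g'])
qed

lemma weight_pairing_int: "lam \<in> weights \<Longrightarrow> \<alpha> \<in> R \<Longrightarrow> pairing lam \<alpha> \<in> \<int>"
  by (simp add: weights_def pairing_def)

lemma zero_weight: "0 \<in> weights"
  and add_weight: "lam \<in> weights \<Longrightarrow> \<mu> \<in> weights \<Longrightarrow> lam + \<mu> \<in> weights"
  and neg_weight: "lam \<in> weights \<Longrightarrow> - lam \<in> weights"
  and root_weight: "\<alpha> \<in> R \<Longrightarrow> \<alpha> \<in> weights"
  unfolding weights_def pairing_def [symmetric]
  by (simp_all add: pairing_0 pairing_add pairing_neg pairing_root_int)

lemma weyl_weight: "w \<in> weyl_group \<Longrightarrow> lam \<in> weights \<Longrightarrow> w lam \<in> weights"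
  unfolding weights_def pairing_def [symmetric]
  using pairing_weyl weyl_root [OF weyl_inv] by simp

text \<open>
  Subtracting \<open>chi \<alpha>\<close> makes the summand of the length an even function on \<open>R\<close>, so that the sum
  can be reindexed by the Weyl group.
\<close>

definition length_term :: "('a \<Rightarrow> 'a) \<Rightarrow> 'a \<Rightarrow> 'a \<Rightarrow> real" where
  "length_term w lam \<alpha> = \<bar>pairing lam \<alpha> + chi (w \<alpha>) - chi \<alpha>\<bar>"

lemma length_term_uminus:
  assumes "w \<in> weyl_group" "\<alpha> \<in> R"
  shows "length_term w lam (- \<alpha>) = length_term w lam \<alpha>"
  using assms
  by (simp add: length_term_def pairing_uminus_right weyl_neg chi_uminus weyl_root)

text \<open>Integrality of the pairings makes \<open>floor\<close> and \<open>nat\<close> exact. The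
  subtracted \<open>chi \<alpha>\<close> vanishes on \<open>Rp\<close>, and evenness trades the sum
  over \<open>Rp\<close> for half of the sum over \<open>R\<close>.\<close>

lemma real_affine_length:
  assumes w: "w \<in> weyl_group" and lam: "lam \<in> weights"
  shows "real (affine_length (w \<circ> translation lam)) = sum (length_term w lam) R / 2"
proof -
  let ?S = "\<Sum>\<alpha>\<in>Rp. \<bar>B lam (coroot B \<alpha>) + chi (w \<alpha>)\<bar>"
  have "?S = sum (length_term w lam) Rp"
    by (intro sum.cong) (auto simp: length_term_def pairing_def chi_pos)
  also have "\<dots> = sum (length_term w lam) R / 2"
    using length_term_uminus [OF w] by (subst sum_roots_even) auto
  finally have S: "?S = sum (length_term w lam) R / 2" .
  have "?S \<in> \<int>"
    using weight_pairing_int [OF lam] pos_root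
    by (intro Ints_sum Ints_abs Ints_add) (auto simp: pairing_def chi_def)
  then obtain k where k: "?S = of_int k" by (auto elim: Ints_cases)
  moreover have "?S \<ge> 0" by (rule sum_nonneg) simp
  ultimately show ?thesis
    unfolding S [symmetric] affine_length_eq [OF w] by simp
qed

lemma translation_0 [simp]: "translation 0 = id"
  by (simp add: translation_def fun_eq_iff)

lemma translation_add: "translation (lam + \<mu>) = translation lam \<circ> translation \<mu>"
  by (simp add: translation_def fun_eq_iff algebra_simps)

lemma translation_weyl: "w \<in> weyl_group \<Longrightarrow> translation (w lam) \<circ> w = w \<circ> translation lam"
  using weyl_linear [of w] by (simp add: translation_def fun_eq_iff linear_add)

text \<open>A translation by \<open>lam\<close> moves past \<open>v\<close> to its right as the
  translation by \<open>inv v lam\<close>.\<close>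

lemma affine_mult:
  assumes "u \<in> weyl_group" "v \<in> weyl_group"
  shows "(u \<circ> translation lam) \<circ> (v \<circ> translation \<mu>) = (u \<circ> v) \<circ> translation (inv v lam + \<mu>)"
  using weyl_linear [OF assms(2)] weyl_f_inv [OF assms(2)]
  by (simp add: translation_def fun_eq_iff linear_add add_ac)

text \<open>A simple reflection changes the sign only of \<alpha> and \<open>- \<alpha>\<close>, so
  only the summands at the roots that \<open>w\<close> maps there change. With \<open>m\<close> the
  pairing of \<open>lam\<close> with \<open>c = inv w \<alpha>\<close>, the value
  \<open>|m - chi c|\<close> becomes \<open>|m - chi c + 1|\<close>, and integrality makes the
  change exactly 1 or -1.\<close>

lemma length_simple_left:
  assumes w: "w \<in> weyl_group" and lam: "lam \<in> weights" and a: "\<alpha> \<in> simple_roots"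
  shows "real (affine_length (reflection B \<alpha> \<circ> (w \<circ> translation lam)))
    = real (affine_length (w \<circ> translation lam))
      + (if pairing lam (inv w \<alpha>) \<ge> chi (inv w \<alpha>) then 1 else -1)"
proof -
  let ?s = "reflection B \<alpha>" and ?c = "inv w \<alpha>"
  have aR: "\<alpha> \<in> R" and s: "?s \<in> weyl_group" using simple_root [OF a] reflection_in_weyl by auto
  have c: "?c \<in> R" using weyl_root [OF weyl_inv [OF w] aR] .
  have sw: "?s \<circ> w \<in> weyl_group" using weyl_comp [OF s w] .
  have "sum (length_term (?s \<circ> w) lam) R = sum (length_term w lam) R
      + 2 * (length_term (?s \<circ> w) lam ?c - length_term w lam ?c)"
  proof (rule sum_roots_change [OF c])
    fix \<beta> assume b: "\<beta> \<in> R" "\<beta> \<noteq> ?c" "\<beta> \<noteq> - ?c"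
    have "w \<beta> \<noteq> \<alpha>" "w \<beta> \<noteq> - \<alpha>"
      using b w weyl_neg [OF w, of ?c] weyl_inv_f [OF w] by (metis, metis weyl_f_inv)
    then show "length_term (?s \<circ> w) lam \<beta> = length_term w lam \<beta>"
      using chi_simple_reflection [OF a weyl_root [OF w b(1)]] by (simp add: length_term_def)
  qed (use length_term_uminus c w sw in auto)
  moreover have "length_term (?s \<circ> w) lam ?c - length_term w lam ?c
      = (if pairing lam ?c \<ge> chi ?c then 1 else -1)"
  proof -
    have "pairing lam ?c - chi ?c \<in> \<int>"
      using weight_pairing_int [OF lam c] by (auto simp: chi_def)
    from abs_Ints_plus_1 [OF this] show ?thesis
      using w chi_pos [OF simple_pos [OF a]] chi_uminus [OF aR]
      by (simp add: length_term_def reflection_self [OF aR] weyl_cancel [OF w] algebra_simps)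
  qed
  ultimately show ?thesis
    using real_affine_length [OF w lam] real_affine_length [OF sw lam]
    by (simp add: comp_assoc [symmetric])
qed

text \<open>Moving the reflection to the left turns the translation part into its image under the
  reflection. After reindexing, the reflection acts only on the subtracted \<open>chi\<close>, so
  again one pair of summands changes: at \<alpha>, from \<open>|m + chi (w \<alpha>)|\<close> to
  \<open>|m + chi (w \<alpha>) - 1|\<close> with \<open>m\<close> the pairing of \<open>lam\<close>
  with \<alpha>.\<close>

lemma length_simple_right:
  assumes w: "w \<in> weyl_group" and lam: "lam \<in> weights" and a: "\<alpha> \<in> simple_roots"
  shows "real (affine_length ((w \<circ> translation lam) \<circ> reflection B \<alpha>))
    = real (affine_length (w \<circ> translation lam))
      + (if pairing lam \<alpha> + chi (w \<alpha>) \<ge> 1 then -1 else 1)"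
proof -
  let ?s = "reflection B \<alpha>"
  have aR: "\<alpha> \<in> R" and s: "?s \<in> weyl_group" using simple_root [OF a] reflection_in_weyl by auto
  have ws: "w \<circ> ?s \<in> weyl_group" using weyl_comp [OF w s] .
  \<comment> \<open>\<open>g (?s \<beta>)\<close> is the length summand of the product at \<beta>,
    written without the reflected weight.\<close>
  define g where "g = (\<lambda>\<beta>. \<bar>pairing lam \<beta> + chi (w \<beta>) - chi (?s \<beta>)\<bar>)"
  have eq: "(w \<circ> translation lam) \<circ> ?s = (w \<circ> ?s) \<circ> translation (?s lam)"
    using affine_mult [OF w s, of lam 0] by (simp add: inv_reflection [OF aR])
  have "sum (length_term (w \<circ> ?s) (?s lam)) R = sum (\<lambda>\<beta>. g (?s \<beta>)) R"
    using pairing_weyl [OF s] inv_reflection [OF aR] reflection_involution [OF aR]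
    by (intro sum.cong) (auto simp: g_def length_term_def)
  also have "\<dots> = sum g R"
    by (rule sum.reindex_bij_betw [OF weyl_bij_betw_roots [OF s]])
  also have "\<dots> = sum (length_term w lam) R + 2 * (g \<alpha> - length_term w lam \<alpha>)"
  proof (rule sum_roots_change [OF aR])
    show "g (- \<alpha>) = g \<alpha>"
      using aR weyl_root [OF w aR] reflection_self [OF aR]
      by (simp add: g_def pairing_uminus_right weyl_neg [OF w] weyl_neg [OF s] chi_uminus)
    show "g \<beta> = length_term w lam \<beta>" if "\<beta> \<in> R" "\<beta> \<noteq> \<alpha>" "\<beta> \<noteq> - \<alpha>" for \<beta>
      using chi_simple_reflection [OF a that] by (simp add: g_def length_term_def)
  qed (rule length_term_uminus [OF w aR])
  moreover have "g \<alpha> - length_term w lam \<alpha> = (if pairing lam \<alpha> + chi (w \<alpha>) \<ge> 1 then -1 else 1)"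
  proof -
    have "pairing lam \<alpha> + chi (w \<alpha>) \<in> \<int>"
      using weight_pairing_int [OF lam aR] by (auto simp: chi_def)
    from abs_Ints_minus_1 [OF this] show ?thesis
      using chi_pos [OF simple_pos [OF a]] chi_uminus [OF aR]
      by (simp add: g_def length_term_def reflection_self [OF aR])
  qed
  ultimately show ?thesis
    unfolding eq using real_affine_length [OF w lam] real_affine_length [OF ws weyl_weight [OF s lam]]
    by argo
qed

text \<open>The element on the left is the inverse of the one on the right, and inside the absolute
  values its summand at \<open>w \<alpha>\<close> is minus the other summand at \<alpha>.\<close>

lemma length_inverse:
  assumes w: "w \<in> weyl_group" and lam: "lam \<in> weights"
  shows "affine_length (inv w \<circ> translation (- w lam)) = affine_length (w \<circ> translation lam)"
proof -
  have "sum (length_term w lam) R = sum (\<lambda>\<beta>. length_term (inv w) (- w lam) (w \<beta>)) R"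
    using weyl_pairing [OF w] w
    by (intro sum.cong) (auto simp: length_term_def pairing_neg weyl_cancel [OF w])
  also have "\<dots> = sum (length_term (inv w) (- w lam)) R"
    by (rule sum.reindex_bij_betw [OF weyl_bij_betw_roots [OF w]])
  finally show ?thesis
    using real_affine_length [OF w lam]
      real_affine_length [OF weyl_inv [OF w] neg_weight [OF weyl_weight [OF w lam]]] by simp
qed

section \<open>Words in simple reflections and the exchange condition\<close>

definition word :: "'a list \<Rightarrow> 'a \<Rightarrow> 'a" where
  "word \<alpha>s = foldr (\<lambda>\<alpha> u. reflection B \<alpha> \<circ> u) \<alpha>s id"

lemma word_simps [simp]:
  "word [] = id" "word (\<alpha> # \<alpha>s) = reflection B \<alpha> \<circ> word \<alpha>s"
  by (simp_all add: word_def)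

lemma word_append: "word (\<alpha>s @ \<beta>s) = word \<alpha>s \<circ> word \<beta>s"
  by (induction \<alpha>s) (simp_all add: comp_assoc)

lemma word_in_weyl: "set \<alpha>s \<subseteq> simple_roots \<Longrightarrow> word \<alpha>s \<in> weyl_group"
  by (induction \<alpha>s) (simp_all only: word_simps weyl_id, simp add: weyl_step simple_root)

lemma weyl_length_eq_word:
  "weyl_length w = (LEAST k. \<exists>\<alpha>s. length \<alpha>s = k \<and> set \<alpha>s \<subseteq> simple_roots \<and> w = word \<alpha>s)"
  by (simp only: weyl_length_def word_def)

text \<open>Some simple root has positive \<open>inv_form\<close> with \<beta>, since otherwise
  induction over positive roots would give \<open>inv_form \<beta> \<beta> \<le> 0\<close>. Its
  reflection lowers \<open>ht \<beta>\<close>, and the reflection in \<beta> is a conjugate of the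
  reflection in the lowered root.\<close>

lemma reflection_pos_word: "\<beta> \<in> Rp \<Longrightarrow> \<exists>\<alpha>s. set \<alpha>s \<subseteq> simple_roots \<and> word \<alpha>s = reflection B \<beta>"
proof (induction rule: ht_induct)
  case (less \<beta>)
  show ?case
  proof (cases "\<beta> \<in> simple_roots")
    case True
    then show ?thesis by (intro exI [of _ "[\<beta>]"]) simp
  next
    case False
    have bR: "\<beta> \<in> R" using pos_root [OF less.hyps] .
    have "\<exists>\<alpha>\<in>simple_roots. inv_form \<alpha> \<beta> > 0"
    proof (rule ccontr)
      assume "\<not> ?thesis"
      then have *: "inv_form \<alpha> \<beta> \<le> 0" if "\<alpha> \<in> simple_roots" for \<alpha> using that by force
      have "inv_form \<gamma> \<beta> \<le> 0" if "\<gamma> \<in> Rp" for \<gamma>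
        using that by (induction rule: pos_induct) (auto simp: inv_form_add dest: *)
      then show False using less.hyps inv_form_root_pos [OF bR] by force
    qed
    then obtain \<alpha> where a: "\<alpha> \<in> simple_roots" and pos: "inv_form \<beta> \<alpha> > 0"
      by (auto simp: inv_form_sym)
    let ?c = "reflection B \<alpha> \<beta>"
    have aR: "\<alpha> \<in> R" using simple_root [OF a] .
    have "pairing \<beta> \<alpha> > 0" using pos inv_form_root_pos [OF aR] by (simp add: pairing_eq [OF aR])
    then have "ht ?c < ht \<beta>"
      using simple_pos [OF a] by (simp add: reflection_pairing ht_diff ht_scale pos_iff)
    moreover have "?c \<in> Rp" using simple_reflection_pos [OF a less.hyps] False a by blast
    ultimately obtain \<alpha>s where s: "set \<alpha>s \<subseteq> simple_roots" "word \<alpha>s = reflection B ?c"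
      using less.IH by blast
    have "reflection B \<beta> = reflection B \<alpha> \<circ> reflection B ?c \<circ> reflection B \<alpha>"
    proof
      fix x
      show "reflection B \<beta> x = (reflection B \<alpha> \<circ> reflection B ?c \<circ> reflection B \<alpha>) x"
        using conjugate_reflection [OF reflection_in_weyl [OF aR], of ?c "reflection B \<alpha> x"]
        by (simp add: reflection_involution [OF aR])
    qed
    then have "word (\<alpha> # \<alpha>s @ [\<alpha>]) = reflection B \<beta>" by (simp add: word_append s comp_assoc)
    then show ?thesis using s a by (intro exI [of _ "\<alpha> # \<alpha>s @ [\<alpha>]"]) simp
  qed
qed

lemma reflection_uminus: "reflection B (- \<alpha>) = reflection B \<alpha>"
  by (simp add: fun_eq_iff reflection_pairing pairing_uminus_right)

lemma weyl_word: "w \<in> weyl_group \<Longrightarrow> \<exists>\<alpha>s. set \<alpha>s \<subseteq> simple_roots \<and> word \<alpha>s = w"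
proof (induction rule: weyl_group.induct)
  case weyl_id
  show ?case by (intro exI [of _ "[]"]) simp
next
  case (weyl_step \<alpha> w)
  then obtain \<alpha>s where s: "set \<alpha>s \<subseteq> simple_roots" "word \<alpha>s = w" by blast
  have "\<exists>\<beta>s. set \<beta>s \<subseteq> simple_roots \<and> word \<beta>s = reflection B \<alpha>"
    using reflection_pos_word [of \<alpha>] reflection_pos_word [of "- \<alpha>"] pos_uminus [OF weyl_step(1)]
      reflection_uminus by metis
  then obtain \<beta>s where "set \<beta>s \<subseteq> simple_roots" "word \<beta>s = reflection B \<alpha>" by blast
  then show ?case using s by (intro exI [of _ "\<beta>s @ \<alpha>s"]) (simp add: word_append)
qed

text \<open>Applying the letters from the right, \<alpha> turns negative at some letter \<beta>. A
  simple reflection makes no positive root negative but its own, so the suffix \<open>u\<close>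
  behind that letter sends \<alpha> to \<beta>. The reflections are then conjugate under
  \<open>u\<close>, and appending the reflection in \<alpha> deletes the letter \<beta>.\<close>

lemma exchange:
  assumes a: "\<alpha> \<in> simple_roots"
  shows "set \<beta>s \<subseteq> simple_roots \<Longrightarrow> word \<beta>s \<alpha> \<notin> Rp \<Longrightarrow>
    \<exists>\<gamma>s. set \<gamma>s \<subseteq> simple_roots \<and> Suc (length \<gamma>s) = length \<beta>s \<and> word \<gamma>s = word \<beta>s \<circ> reflection B \<alpha>"
proof (induction \<beta>s)
  case Nil
  then show ?case using simple_pos [OF a] by simp
next
  case (Cons \<beta> \<beta>s)
  let ?u = "word \<beta>s"
  have b: "\<beta> \<in> simple_roots" and bs: "set \<beta>s \<subseteq> simple_roots" using Cons.prems by auto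
  have u: "?u \<in> weyl_group" using word_in_weyl [OF bs] .
  show ?case
  proof (cases "?u \<alpha> \<in> Rp")
    case False
    then obtain \<gamma>s where "set \<gamma>s \<subseteq> simple_roots" "Suc (length \<gamma>s) = length \<beta>s"
      "word \<gamma>s = ?u \<circ> reflection B \<alpha>" using Cons.IH [OF bs] by blast
    then show ?thesis using b by (intro exI [of _ "\<beta> # \<gamma>s"]) (simp add: comp_assoc)
  next
    case True
    have "?u \<alpha> = \<beta>"
    proof (rule ccontr)
      assume "?u \<alpha> \<noteq> \<beta>"
      then show False using simple_reflection_pos [OF b True] Cons.prems by simp
    qed
    then have "reflection B \<beta> \<circ> ?u = ?u \<circ> reflection B \<alpha>"
      using conjugate_reflection [OF u, of \<alpha>] by (auto simp: fun_eq_iff)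
    then have "word (\<beta> # \<beta>s) \<circ> reflection B \<alpha> = ?u"
      by (simp add: comp_assoc reflection_comp_self [OF simple_root [OF a]])
    then show ?thesis using bs by (intro exI [of _ \<beta>s]) (simp del: word_simps)
  qed
qed

text \<open>If a word for \<open>w\<close> ends in \<alpha>, then its remaining part sends \<alpha>
  to \<open>- w \<alpha>\<close>, a negative root. The exchange condition therefore yields a word
  for \<open>w\<close> that is shorter by two, and the descent can stop only at the empty
  word.\<close>

lemma weyl_all_simple_pos_id:
  assumes "w \<in> weyl_group" and "\<And>\<alpha>. \<alpha> \<in> simple_roots \<Longrightarrow> w \<alpha> \<in> Rp"
  shows "w = id"
proof -
  have "set \<beta>s \<subseteq> simple_roots \<Longrightarrow> word \<beta>s = w \<Longrightarrow> w = id" for \<beta>s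
  proof (induction "length \<beta>s" arbitrary: \<beta>s rule: less_induct)
    case less
    show ?case
    proof (cases \<beta>s rule: rev_cases)
      case Nil
      then show ?thesis using less.prems by simp
    next
      case (snoc \<gamma>s \<alpha>)
      have a: "\<alpha> \<in> simple_roots" and gs: "set \<gamma>s \<subseteq> simple_roots" using less.prems snoc by auto
      have w: "w = word \<gamma>s \<circ> reflection B \<alpha>" using less.prems snoc by (simp add: word_append)
      have g: "word \<gamma>s \<in> weyl_group" using word_in_weyl [OF gs] .
      have "- word \<gamma>s \<alpha> \<in> Rp"
        using assms(2) [OF a] w reflection_self [OF simple_root [OF a]] weyl_neg [OF g] by simp
      then have "word \<gamma>s \<alpha> \<notin> Rp" using pos_uminus weyl_root [OF g simple_root [OF a]] by blast
      then obtain \<delta>s where "set \<delta>s \<subseteq> simple_roots" "Suc (length \<delta>s) = length \<gamma>s" "word \<delta>s = w"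
        using exchange [OF a gs] w by auto
      then show ?thesis using less.hyps [of \<delta>s] snoc by simp
    qed
  qed
  then show ?thesis using weyl_word [OF assms(1)] by blast
qed

section \<open>The length on the finite Weyl group\<close>

lemma length_id [simp]: "affine_length id = 0"
  using real_affine_length [OF weyl_id zero_weight]
  by (simp add: length_term_def [abs_def] pairing_0)

lemma length_weyl:
  "w \<in> weyl_group \<Longrightarrow> real (affine_length w) = (\<Sum>\<alpha>\<in>R. \<bar>chi (w \<alpha>) - chi \<alpha>\<bar>) / 2"
  using real_affine_length [OF _ zero_weight, of w]
  by (simp add: length_term_def [abs_def] pairing_0)

lemma length_weyl_right:
  assumes w: "w \<in> weyl_group" and a: "\<alpha> \<in> simple_roots"
  shows "real (affine_length (w \<circ> reflection B \<alpha>))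
    = real (affine_length w) + (if w \<alpha> \<in> Rp then 1 else -1)"
  using length_simple_right [OF w zero_weight a] by (auto simp: pairing_0 chi_def)

lemma length_weyl_left:
  assumes w: "w \<in> weyl_group" and a: "\<alpha> \<in> simple_roots"
  shows "real (affine_length (reflection B \<alpha> \<circ> w))
    = real (affine_length w) + (if inv w \<alpha> \<in> Rp then 1 else -1)"
  using length_simple_left [OF w zero_weight a] by (auto simp: pairing_0 chi_def)

lemma length_weyl_inv: "w \<in> weyl_group \<Longrightarrow> affine_length (inv w) = affine_length w"
  using length_inverse [OF _ zero_weight, of w] linear_0 [OF weyl_linear, of w] by simp

text \<open>An element other than the identity sends some simple root to a negative one, and
  multiplying by that reflection on the right shortens it. The premise
  \<open>w \<alpha> \<in> Rp\<close> records that each step raises the length.\<close>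

lemma weyl_induct_right [consumes 1, case_names id step]:
  assumes "w \<in> weyl_group"
    and "P id"
    and step: "\<And>w \<alpha>. w \<in> weyl_group \<Longrightarrow> \<alpha> \<in> simple_roots \<Longrightarrow> w \<alpha> \<in> Rp \<Longrightarrow> P w \<Longrightarrow> P (w \<circ> reflection B \<alpha>)"
  shows "P w"
  using assms(1)
proof (induction "affine_length w" arbitrary: w rule: less_induct)
  case less
  show ?case
  proof (cases "\<forall>\<alpha>\<in>simple_roots. w \<alpha> \<in> Rp")
    case True
    then have "w = id" using weyl_all_simple_pos_id [OF less.prems] by blast
    then show ?thesis using assms(2) by (simp only:)
  next
    case False
    then obtain \<alpha> where a: "\<alpha> \<in> simple_roots" "w \<alpha> \<notin> Rp" by blast
    let ?s = "reflection B \<alpha>"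
    have aR: "\<alpha> \<in> R" using simple_root [OF a(1)] .
    have ws: "w \<circ> ?s \<in> weyl_group" using weyl_comp [OF less.prems reflection_in_weyl [OF aR]] .
    have "affine_length (w \<circ> ?s) < affine_length w" using length_weyl_right [OF less.prems a(1)] a(2) by simp
    then have "P (w \<circ> ?s)" using less.hyps ws by blast
    moreover have "(w \<circ> ?s) \<alpha> \<in> Rp"
      using a(2) weyl_root [OF less.prems aR] pos_uminus by (simp add: reflection_self [OF aR] weyl_neg [OF less.prems])
    ultimately have "P ((w \<circ> ?s) \<circ> ?s)" using step [OF ws a(1)] by blast
    then show ?thesis by (simp only: comp_assoc reflection_comp_self [OF aR] comp_id)
  qed
qed

lemma weyl_induct_left [consumes 1, case_names id step]:
  assumes w: "w \<in> weyl_group"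
    and "P id"
    and step: "\<And>w \<alpha>. w \<in> weyl_group \<Longrightarrow> \<alpha> \<in> simple_roots \<Longrightarrow> inv w \<alpha> \<in> Rp \<Longrightarrow> P w \<Longrightarrow> P (reflection B \<alpha> \<circ> w)"
  shows "P w"
proof -
  have "P (inv (inv w))"
    using weyl_inv [OF w]
  proof (induction rule: weyl_induct_right)
    case id
    show ?case using assms(2) by (simp only: inv_id)
  next
    case (step u \<alpha>)
    have aR: "\<alpha> \<in> R" using simple_root [OF step(2)] .
    have "P (reflection B \<alpha> \<circ> inv u)"
      using assms(3) [OF weyl_inv [OF step(1)] step(2)] step(1,3,4) by simp
    moreover have "inv (u \<circ> reflection B \<alpha>) = reflection B \<alpha> \<circ> inv u"
      using weyl_bij [OF step(1)] weyl_bij [OF reflection_in_weyl [OF aR]]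
      by (simp add: o_inv_distrib inv_reflection [OF aR])
    ultimately show ?case by (simp only:)
  qed
  then show ?thesis using w by (simp only: weyl_inv_inv)
qed

text \<open>Reconciles the length by words, used in the Poincare polynomials, with the length by
  roots. Building \<open>w\<close> by length-raising steps gives a word with
  \<open>affine_length w\<close> letters; no word is shorter, because a letter raises
  \<open>affine_length\<close> by at most 1.\<close>

lemma weyl_length_eq:
  assumes w: "w \<in> weyl_group"
  shows "weyl_length w = affine_length w"
  unfolding weyl_length_eq_word
proof (rule Least_equality)
  show "\<exists>\<alpha>s. length \<alpha>s = affine_length w \<and> set \<alpha>s \<subseteq> simple_roots \<and> w = word \<alpha>s"
    using w
  proof (induction rule: weyl_induct_right)
    case id
    show ?case by (intro exI [of _ "[]"]) (simp only: length_id word_simps, simp)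
  next
    case (step w \<alpha>)
    then obtain \<alpha>s where s: "length \<alpha>s = affine_length w" "set \<alpha>s \<subseteq> simple_roots" "w = word \<alpha>s" by blast
    have "affine_length (w \<circ> reflection B \<alpha>) = Suc (affine_length w)"
      using length_weyl_right [OF step(1,2)] step(3) by simp
    moreover have "w \<circ> reflection B \<alpha> = word (\<alpha>s @ [\<alpha>])" by (simp add: word_append s(3))
    ultimately show ?case using s step(2) by (intro exI [of _ "\<alpha>s @ [\<alpha>]"]) simp
  qed
next
  fix k assume "\<exists>\<alpha>s. length \<alpha>s = k \<and> set \<alpha>s \<subseteq> simple_roots \<and> w = word \<alpha>s"
  then obtain \<alpha>s where s: "length \<alpha>s = k" "set \<alpha>s \<subseteq> simple_roots" "w = word \<alpha>s" by blast
  have "set \<alpha>s \<subseteq> simple_roots \<Longrightarrow> affine_length (word \<alpha>s) \<le> length \<alpha>s"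
  proof (induction \<alpha>s)
    case Nil
    show ?case by (simp only: word_simps length_id)
  next
    case (Cons \<alpha> \<alpha>s)
    then have "real (affine_length (word (\<alpha> # \<alpha>s))) \<le> real (affine_length (word \<alpha>s)) + 1"
      using length_weyl_left [OF word_in_weyl, of \<alpha>s \<alpha>] by (simp only: word_simps) simp
    then show ?case using Cons by (simp del: word_simps)
  qed
  then show "affine_length w \<le> k" using s by simp
qed

section \<open>Stabilizers and minimal coset representatives\<close>

text \<open>The minimal representatives \<open>v\<close> of the cosets \<open>W_lam v\<close>. The
  condition is put on all positive roots orthogonal to \<open>lam\<close>, not on lengths, so that
  the length formulas can be verified root by root.\<close>

definition min_reps :: "'a \<Rightarrow> ('a \<Rightarrow> 'a) set" where
  "min_reps lam = {v \<in> weyl_group. \<forall>\<gamma>\<in>Rp. pairing lam \<gamma> = 0 \<longrightarrow> inv v \<gamma> \<in> Rp}"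

lemma dominant_weight: "lam \<in> dominant_weights \<Longrightarrow> lam \<in> weights"
  by (simp add: dominant_weights_def)

lemma dominant_nonneg: "lam \<in> dominant_weights \<Longrightarrow> \<alpha> \<in> Rp \<Longrightarrow> pairing lam \<alpha> \<ge> 0"
  by (simp add: dominant_weights_def pairing_def)

lemma dominant_nonpos:
  assumes "lam \<in> dominant_weights" "\<alpha> \<in> R" "\<alpha> \<notin> Rp"
  shows "pairing lam \<alpha> \<le> 0"
  using dominant_nonneg [OF assms(1), of "- \<alpha>"] assms(2,3)
  by (simp add: pos_uminus pairing_uminus_right)

lemma min_reps_weyl: "v \<in> min_reps lam \<Longrightarrow> v \<in> weyl_group"
  by (simp add: min_reps_def)

lemma id_min_reps: "id \<in> min_reps lam"
  unfolding min_reps_def by (simp only: inv_id mem_Collect_eq weyl_id id_apply) simp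

lemma min_reps_chi:
  assumes v: "v \<in> min_reps lam" and g: "\<gamma> \<in> R" "pairing lam \<gamma> = 0"
  shows "chi (inv v \<gamma>) = chi \<gamma>"
proof (cases "\<gamma> \<in> Rp")
  case True
  then show ?thesis using v g by (simp add: min_reps_def chi_def)
next
  case False
  then have "- \<gamma> \<in> Rp" "pairing lam (- \<gamma>) = 0" using g by (simp_all add: pos_uminus pairing_uminus_right)
  then have "inv v (- \<gamma>) \<in> Rp" using v by (simp add: min_reps_def)
  then have "inv v \<gamma> \<notin> Rp"
    using weyl_inv [OF min_reps_weyl [OF v]] g(1) by (simp add: weyl_neg pos_uminus weyl_root)
  then show ?thesis using False by (simp add: chi_def)
qed

lemma stabilizer_weyl: "a \<in> stabilizer lam \<Longrightarrow> a \<in> weyl_group"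
  and stabilizer_fix: "a \<in> stabilizer lam \<Longrightarrow> a lam = lam"
  by (simp_all add: stabilizer_def)

lemma stabilizer_pairing: "a \<in> stabilizer lam \<Longrightarrow> pairing lam (a \<gamma>) = pairing lam \<gamma>"
  using weyl_pairing [of a lam \<gamma>] by (simp add: stabilizer_def)

lemma stabilizer_inv: "a \<in> stabilizer lam \<Longrightarrow> inv a \<in> stabilizer lam"
  using weyl_inv_f [of a lam] weyl_inv by (simp add: stabilizer_def)

lemma stabilizer_comp: "a \<in> stabilizer lam \<Longrightarrow> b \<in> stabilizer lam \<Longrightarrow> a \<circ> b \<in> stabilizer lam"
  using weyl_comp by (simp add: stabilizer_def)

lemma id_stabilizer: "id \<in> stabilizer lam"
  unfolding stabilizer_def by (simp only: mem_Collect_eq weyl_id id_apply)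

lemma stabilizer_0: "stabilizer 0 = weyl_group"
  using linear_0 weyl_linear by (auto simp: stabilizer_def)

lemma finite_stabilizer: "finite (stabilizer lam)"
  using finite_weyl by (rule rev_finite_subset) (auto simp: stabilizer_weyl)

text \<open>On roots not orthogonal to the dominant weight \<open>lam\<close>, positivity is the
  sign of the pairing with \<open>lam\<close>, which the stabilizer preserves.\<close>

lemma stabilizer_chi:
  assumes lam: "lam \<in> dominant_weights" and a: "a \<in> stabilizer lam"
    and g: "\<gamma> \<in> R" "pairing lam \<gamma> \<noteq> 0"
  shows "chi (a \<gamma>) = chi \<gamma>"
proof -
  have "a \<gamma> \<in> R" using weyl_root [OF stabilizer_weyl [OF a] g(1)] .
  moreover have "\<delta> \<in> Rp \<longleftrightarrow> pairing lam \<delta> > 0" if "\<delta> \<in> R" "pairing lam \<delta> \<noteq> 0" for \<delta>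
    using dominant_nonneg [OF lam, of \<delta>] dominant_nonpos [OF lam that(1)] that by force
  ultimately show ?thesis using g stabilizer_pairing [OF a, of \<gamma>] by (simp add: chi_def)
qed

text \<open>No root changes sign twice on the way from \<alpha> through \<open>v \<alpha>\<close> to
  \<open>a (v \<alpha>)\<close>: if \<open>v \<alpha>\<close> is orthogonal to \<open>lam\<close>,
  then \<open>v\<close> keeps the sign, and otherwise \<open>a\<close> does.\<close>

lemma length_stabilizer_min_rep:
  assumes lam: "lam \<in> dominant_weights" and a: "a \<in> stabilizer lam" and v: "v \<in> min_reps lam"
  shows "affine_length (a \<circ> v) = affine_length a + affine_length v"
proof -
  have aW: "a \<in> weyl_group" and vW: "v \<in> weyl_group"
    using stabilizer_weyl [OF a] min_reps_weyl [OF v] .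
  have "(\<Sum>\<alpha>\<in>R. \<bar>chi ((a \<circ> v) \<alpha>) - chi \<alpha>\<bar>)
    = (\<Sum>\<alpha>\<in>R. \<bar>chi (a (v \<alpha>)) - chi (v \<alpha>)\<bar> + \<bar>chi (v \<alpha>) - chi \<alpha>\<bar>)"
  proof (rule sum.cong [OF refl])
    fix \<alpha> assume "\<alpha> \<in> R"
    then have R: "v \<alpha> \<in> R" using weyl_root [OF vW] by blast
    have "chi (v \<alpha>) = chi \<alpha> \<or> chi (a (v \<alpha>)) = chi (v \<alpha>)"
      using min_reps_chi [OF v R] stabilizer_chi [OF lam a R] by (metis weyl_inv_f [OF vW])
    then show "\<bar>chi ((a \<circ> v) \<alpha>) - chi \<alpha>\<bar> = \<bar>chi (a (v \<alpha>)) - chi (v \<alpha>)\<bar> + \<bar>chi (v \<alpha>) - chi \<alpha>\<bar>"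
      by auto
  qed
  also have "\<dots> = (\<Sum>\<alpha>\<in>R. \<bar>chi (a \<alpha>) - chi \<alpha>\<bar>) + (\<Sum>\<alpha>\<in>R. \<bar>chi (v \<alpha>) - chi \<alpha>\<bar>)"
    using sum.reindex_bij_betw [OF weyl_bij_betw_roots [OF vW], of "\<lambda>\<beta>. \<bar>chi (a \<beta>) - chi \<beta>\<bar>"]
    by (simp add: sum.distrib)
  finally show ?thesis
    using length_weyl [OF aW] length_weyl [OF vW] length_weyl [OF weyl_comp [OF aW vW]] by simp
qed

lemma length_zero_id:
  assumes "w \<in> weyl_group" and "affine_length w = 0"
  shows "w = id"
proof (rule weyl_all_simple_pos_id [OF assms(1)])
  fix \<alpha> assume "\<alpha> \<in> simple_roots"
  then show "w \<alpha> \<in> Rp" using length_weyl_right [OF assms(1)] assms(2) by (force split: if_splits)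
qed

text \<open>Additivity applies to \<open>a\<close> acting on \<open>v\<close> and to
  \<open>inv a\<close> acting on \<open>a \<circ> v\<close>; together the two equations force
  \<open>a\<close> to have length 0.\<close>

lemma min_rep_unique:
  assumes lam: "lam \<in> dominant_weights" and a: "a \<in> stabilizer lam" and v: "v \<in> min_reps lam"
    and av: "a \<circ> v \<in> min_reps lam"
  shows "a = id"
proof -
  have aW: "a \<in> weyl_group" using stabilizer_weyl [OF a] .
  have "inv a \<circ> (a \<circ> v) = v" by (simp add: fun_eq_iff weyl_cancel [OF aW])
  then have "affine_length v = affine_length (inv a) + affine_length (a \<circ> v)"
    using length_stabilizer_min_rep [OF lam stabilizer_inv [OF a] av] by simp
  then show ?thesis
    using length_stabilizer_min_rep [OF lam a v] by (intro length_zero_id aW) simp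
qed

text \<open>\<open>pairing\<close> is not additive in the root, since coroots are not.
  \<open>inv_form\<close> is additive and has the same sign, so inductions over sums of roots go
  through it.\<close>

lemma pairing_sgn:
  assumes "\<alpha> \<in> R"
  shows "pairing x \<alpha> = 0 \<longleftrightarrow> inv_form x \<alpha> = 0" "pairing x \<alpha> \<ge> 0 \<longleftrightarrow> inv_form x \<alpha> \<ge> 0"
  using inv_form_root_pos [OF assms] root_nonzero [OF assms]
  by (auto simp: pairing_eq [OF assms] zero_le_divide_iff)

text \<open>In a sum of two positive roots both values of \<open>inv_form \<mu>\<close> are
  nonnegative. If the total is 0, both vanish, so \<open>w\<close> sends both summands, and with
  them the sum, to positive roots.\<close>

lemma dominant_on_pos:
  assumes dom: "\<And>\<alpha>. \<alpha> \<in> simple_roots \<Longrightarrow> pairing \<mu> \<alpha> \<ge> 0" and w: "w \<in> weyl_group"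
    and zero: "\<And>\<alpha>. \<alpha> \<in> simple_roots \<Longrightarrow> pairing \<mu> \<alpha> = 0 \<Longrightarrow> w \<alpha> \<in> Rp"
    and g: "\<gamma> \<in> Rp"
  shows "pairing \<mu> \<gamma> \<ge> 0" "pairing \<mu> \<gamma> = 0 \<Longrightarrow> w \<gamma> \<in> Rp"
proof -
  have "inv_form \<mu> \<gamma> \<ge> 0 \<and> (inv_form \<mu> \<gamma> = 0 \<longrightarrow> w \<gamma> \<in> Rp)"
    using g
  proof (induction rule: pos_induct)
    case (simple \<alpha>)
    then show ?case using dom [OF simple] zero [OF simple] pairing_sgn [OF simple_root] by auto
  next
    case (add \<beta> \<gamma>)
    have "w (\<beta> + \<gamma>) \<in> Rp" if "w \<beta> \<in> Rp" "w \<gamma> \<in> Rp"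
      using that weyl_root [OF w pos_root [OF add(3)]]
      by (simp add: pos_iff linear_add [OF weyl_linear [OF w]] ht_add)
    then show ?case using add by (auto simp: inv_form_add_right)
  qed
  then show "pairing \<mu> \<gamma> \<ge> 0" "pairing \<mu> \<gamma> = 0 \<Longrightarrow> w \<gamma> \<in> Rp"
    using pairing_sgn [OF pos_root [OF g]] by auto
qed

text \<open>Simple reflections that fix \<open>lam\<close> and shorten \<open>w\<close> on the left
  are split off until none is left. \<open>dominant_on_pos\<close> shows that testing simple roots
  orthogonal to \<open>lam\<close> suffices for membership in \<open>min_reps lam\<close>.\<close>

lemma min_rep_exists:
  assumes lam: "lam \<in> dominant_weights"
  shows "w \<in> weyl_group \<Longrightarrow> \<exists>a\<in>stabilizer lam. \<exists>v\<in>min_reps lam. w = a \<circ> v"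
proof (induction "affine_length w" arbitrary: w rule: less_induct)
  case less
  show ?case
  proof (cases "\<forall>\<alpha>\<in>simple_roots. pairing lam \<alpha> = 0 \<longrightarrow> inv w \<alpha> \<in> Rp")
    case True
    have "pairing lam \<gamma> = 0 \<longrightarrow> inv w \<gamma> \<in> Rp" if "\<gamma> \<in> Rp" for \<gamma>
      using dominant_on_pos(2) [OF dominant_nonneg [OF lam simple_pos] weyl_inv [OF less.prems] _ that]
        True by blast
    then have "w \<in> min_reps lam" using less.prems by (simp add: min_reps_def)
    then show ?thesis using id_stabilizer [of lam] by (intro bexI [of _ id] bexI [of _ w]) auto
  next
    case False
    then obtain \<alpha> where a: "\<alpha> \<in> simple_roots" "pairing lam \<alpha> = 0" "inv w \<alpha> \<notin> Rp" by blast
    let ?s = "reflection B \<alpha>"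
    have aR: "\<alpha> \<in> R" using simple_root [OF a(1)] .
    have s: "?s \<in> stabilizer lam"
      using reflection_in_weyl [OF aR] a(2) by (simp add: stabilizer_def reflection_pairing)
    have "affine_length (?s \<circ> w) < affine_length w" using length_weyl_left [OF less.prems a(1)] a(3) by simp
    then obtain b v where b: "b \<in> stabilizer lam" "v \<in> min_reps lam" "?s \<circ> w = b \<circ> v"
      using less.hyps weyl_comp [OF reflection_in_weyl [OF aR] less.prems] by blast
    have "?s \<circ> (?s \<circ> w) = (?s \<circ> b) \<circ> v" by (simp only: b(3) comp_assoc)
    then have "w = (?s \<circ> b) \<circ> v"
      by (simp only: comp_assoc [symmetric] reflection_comp_self [OF aR] id_comp)
    then show ?thesis using stabilizer_comp [OF s b(1)] b(2) by blast
  qed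
qed

lemma bij_betw_stabilizer_min_reps:
  assumes lam: "lam \<in> dominant_weights"
  shows "bij_betw (\<lambda>(a, v). a \<circ> v) (stabilizer lam \<times> min_reps lam) weyl_group"
  unfolding bij_betw_def
proof
  show "inj_on (\<lambda>(a, v). a \<circ> v) (stabilizer lam \<times> min_reps lam)"
  proof (rule inj_onI, clarify)
    fix a v b u
    assume a: "a \<in> stabilizer lam" "v \<in> min_reps lam" and b: "b \<in> stabilizer lam" "u \<in> min_reps lam"
      and eq: "a \<circ> v = b \<circ> u"
    have aW: "a \<in> weyl_group" and bW: "b \<in> weyl_group" using stabilizer_weyl a b by auto
    have u: "(inv b \<circ> a) \<circ> v = u"
    proof
      fix x
      show "((inv b \<circ> a) \<circ> v) x = u x" using fun_cong [OF eq, of x] by (simp add: weyl_cancel [OF bW])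
    qed
    have "inv b \<circ> a = id"
      using min_rep_unique [OF lam stabilizer_comp [OF stabilizer_inv [OF b(1)] a(1)] a(2)] b(2) u by simp
    then have "b \<circ> (inv b \<circ> a) = b" and "v = u" using u by (simp_all only: comp_id id_comp)
    moreover have "b \<circ> (inv b \<circ> a) = a" by (simp add: fun_eq_iff weyl_cancel [OF bW])
    ultimately show "a = b \<and> v = u" by simp
  qed
  show "(\<lambda>(a, v). a \<circ> v) ` (stabilizer lam \<times> min_reps lam) = weyl_group"
    using min_rep_exists [OF lam] weyl_comp stabilizer_weyl min_reps_weyl
    by (auto simp: image_iff)
qed

section \<open>The extended affine Weyl group\<close>

lemma affine_group_iff:
  "x \<in> ext_affine_weyl_group \<longleftrightarrow> (\<exists>w\<in>weyl_group. \<exists>lam\<in>weights. x = w \<circ> translation lam)"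
  by (auto simp: ext_affine_weyl_group_def)

lemma affine_groupI: "w \<in> weyl_group \<Longrightarrow> lam \<in> weights \<Longrightarrow> w \<circ> translation lam \<in> ext_affine_weyl_group"
  by (auto simp: affine_group_iff)

lemma affine_groupE:
  assumes "x \<in> ext_affine_weyl_group"
  obtains w lam where "w \<in> weyl_group" "lam \<in> weights" "x = w \<circ> translation lam"
  using assms by (auto simp: affine_group_iff)

lemma weyl_affine: "w \<in> weyl_group \<Longrightarrow> w \<in> ext_affine_weyl_group"
  using affine_groupI [OF _ zero_weight, of w] by simp

lemma translation_affine: "lam \<in> weights \<Longrightarrow> translation lam \<in> ext_affine_weyl_group"
  using affine_groupI [OF weyl_id, of lam] by simp

lemma affine_comp:
  assumes "x \<in> ext_affine_weyl_group" "y \<in> ext_affine_weyl_group"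
  shows "x \<circ> y \<in> ext_affine_weyl_group"
proof -
  obtain u lam v \<mu> where "u \<in> weyl_group" "lam \<in> weights" "x = u \<circ> translation lam"
    "v \<in> weyl_group" "\<mu> \<in> weights" "y = v \<circ> translation \<mu>"
    using assms by (elim affine_groupE) blast
  then show ?thesis
    using affine_mult [of u v lam \<mu>]
      affine_groupI [OF weyl_comp add_weight [OF weyl_weight [OF weyl_inv]], of u v v lam \<mu>] by (simp only:)
qed

lemma affine_inverse:
  assumes "x \<in> ext_affine_weyl_group"
  obtains y where "y \<in> ext_affine_weyl_group" "x \<circ> y = id" "y \<circ> x = id"
    "affine_length y = affine_length x"
proof -
  obtain w lam where w: "w \<in> weyl_group" and lam: "lam \<in> weights" and x: "x = w \<circ> translation lam"
    using assms by (rule affine_groupE)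
  let ?y = "inv w \<circ> translation (- w lam)"
  have lin: "linear w" "linear (inv w)" using w weyl_linear weyl_inv by auto
  have "x \<circ> ?y = id" "?y \<circ> x = id"
    by (auto simp: x fun_eq_iff translation_def weyl_cancel [OF w] linear_add [OF lin(1)] linear_add [OF lin(2)]
        linear_neg [OF lin(2)])
  then show thesis
    using that affine_groupI [OF weyl_inv [OF w] neg_weight [OF weyl_weight [OF w lam]]]
      length_inverse [OF w lam] x by blast
qed

lemma length_simple_left_cases:
  assumes "x \<in> ext_affine_weyl_group" and "\<alpha> \<in> simple_roots"
  shows "affine_length (reflection B \<alpha> \<circ> x) = affine_length x + 1
    \<or> affine_length x = affine_length (reflection B \<alpha> \<circ> x) + 1"
  using assms(1) by (rule affine_groupE) (use length_simple_left [OF _ _ assms(2)] in \<open>force split: if_splits\<close>)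

lemma length_simple_right_cases:
  assumes "x \<in> ext_affine_weyl_group" and "\<alpha> \<in> simple_roots"
  shows "affine_length (x \<circ> reflection B \<alpha>) = affine_length x + 1
    \<or> affine_length x = affine_length (x \<circ> reflection B \<alpha>) + 1"
  using assms(1) by (rule affine_groupE) (use length_simple_right [OF _ _ assms(2)] in \<open>force split: if_splits\<close>)

section \<open>Lengths of translations and structure of double cosets\<close>

lemma length_translation:
  assumes "lam \<in> weights"
  shows "real (affine_length (translation lam)) = (\<Sum>\<alpha>\<in>R. \<bar>pairing lam \<alpha>\<bar>) / 2"
  using real_affine_length [OF weyl_id assms] by (simp add: length_term_def [abs_def])

text \<open>At each root the pairings with two dominant weights do not have opposite signs, so their
  absolute values add.\<close>

lemma length_translation_add:
  assumes "lam \<in> dominant_weights" "\<mu> \<in> dominant_weights"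
  shows "affine_length (translation (lam + \<mu>)) = affine_length (translation lam) + affine_length (translation \<mu>)"
proof -
  have "\<bar>pairing (lam + \<mu>) \<alpha>\<bar> = \<bar>pairing lam \<alpha>\<bar> + \<bar>pairing \<mu> \<alpha>\<bar>" if "\<alpha> \<in> R" for \<alpha>
    using assms [THEN dominant_nonneg, of \<alpha>] assms [THEN dominant_nonpos, OF that]
    by (cases "\<alpha> \<in> Rp") (simp_all add: pairing_add)
  then show ?thesis
    using assms [THEN dominant_weight, THEN length_translation]
      length_translation [OF add_weight [OF assms [THEN dominant_weight]]]
    by (simp add: sum.distrib)
qed

text \<open>Holds root by root after reindexing by \<open>v\<close>. At a root orthogonal to
  \<open>lam\<close>, \<open>v\<close> causes no sign change. At any other root the pairing is at
  least 1 in absolute value, which removes the absolute value around the summand, and the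
  contribution of \<open>v\<close> cancels. Having \<open>affine_length v\<close> on the left avoids
  subtraction of natural numbers.\<close>

lemma length_double_coset:
  assumes lam: "lam \<in> dominant_weights" and u: "u \<in> weyl_group" and v: "v \<in> min_reps lam"
  shows "affine_length (u \<circ> translation lam \<circ> v) + affine_length v
    = affine_length u + affine_length (translation lam)"
proof -
  have vW: "v \<in> weyl_group" using min_reps_weyl [OF v] .
  have P: "lam \<in> weights" using dominant_weight [OF lam] .
  define g where "g = (\<lambda>\<delta>. \<bar>pairing lam \<delta> + chi (u \<delta>) - chi (inv v \<delta>)\<bar>)"
  define h where "h = (\<lambda>\<delta>. \<bar>chi \<delta> - chi (inv v \<delta>)\<bar>)"
  have reindex: "(\<Sum>\<alpha>\<in>R. f (v \<alpha>)) = sum f R" for f :: "'a \<Rightarrow> real"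
    by (rule sum.reindex_bij_betw [OF weyl_bij_betw_roots [OF vW]])
  have "u \<circ> translation lam \<circ> v = (u \<circ> v) \<circ> translation (inv v lam)"
    using affine_mult [OF u vW, of lam 0] by simp
  moreover have "sum (length_term (u \<circ> v) (inv v lam)) R = (\<Sum>\<alpha>\<in>R. g (v \<alpha>))"
    by (intro sum.cong) (simp_all add: length_term_def g_def pairing_inv_weyl [OF vW] weyl_cancel [OF vW])
  ultimately have 1: "real (affine_length (u \<circ> translation lam \<circ> v)) = sum g R / 2"
    using real_affine_length [OF weyl_comp [OF u vW] weyl_weight [OF weyl_inv [OF vW] P]]
    by (simp only: reindex)
  have "(\<Sum>\<alpha>\<in>R. \<bar>chi (v \<alpha>) - chi \<alpha>\<bar>) = (\<Sum>\<alpha>\<in>R. h (v \<alpha>))"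
    by (intro sum.cong) (simp_all add: h_def weyl_cancel [OF vW])
  then have 2: "real (affine_length v) = sum h R / 2"
    using length_weyl [OF vW] by (simp only: reindex)
  have "g \<delta> + h \<delta> = \<bar>chi (u \<delta>) - chi \<delta>\<bar> + \<bar>pairing lam \<delta>\<bar>" if d: "\<delta> \<in> R" for \<delta>
  proof -
    obtain k where k: "pairing lam \<delta> = of_int k"
      using weight_pairing_int [OF P d] by (auto elim: Ints_cases)
    have *: "k = 0 \<Longrightarrow> chi (inv v \<delta>) = chi \<delta>" using min_reps_chi [OF v d] k by simp
    show ?thesis
    proof (cases "\<delta> \<in> Rp")
      case True
      then have "k \<ge> 0" using dominant_nonneg [OF lam True] k by simp
      then consider "k = 0" | "k \<ge> 1" by linarith
      then show ?thesis
        using * chi_cases [of "u \<delta>"] chi_cases [of "inv v \<delta>"]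
        by cases (auto simp: g_def h_def k chi_pos [OF True])
    next
      case False
      then have "k \<le> 0" using dominant_nonpos [OF lam d False] k by simp
      then consider "k = 0" | "k \<le> -1" by linarith
      then show ?thesis
        using * chi_cases [of "u \<delta>"] chi_cases [of "inv v \<delta>"]
        by cases (auto simp: g_def h_def k chi_not_pos [OF False])
    qed
  qed
  then have "sum g R + sum h R = (\<Sum>\<alpha>\<in>R. \<bar>chi (u \<alpha>) - chi \<alpha>\<bar>) + (\<Sum>\<alpha>\<in>R. \<bar>pairing lam \<alpha>\<bar>)"
    by (simp add: sum.distrib [symmetric])
  then show ?thesis
    using 1 2 length_weyl [OF u] length_translation [OF P] by linarith
qed

text \<open>For injectivity, evaluation at 0 gives \<open>u lam = u' lam\<close>, so
  \<open>inv u' \<circ> u\<close> stabilizes \<open>lam\<close> and carries \<open>v\<close> to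
  \<open>v'\<close>, where minimality makes it the identity. For surjectivity, the stabilizer part
  of the right factor commutes with the translation and is absorbed into the left factor.\<close>

lemma bij_betw_double_coset:
  assumes lam: "lam \<in> dominant_weights"
  shows "bij_betw (\<lambda>(u, v). u \<circ> translation lam \<circ> v) (weyl_group \<times> min_reps lam) (double_coset lam)"
  unfolding bij_betw_def
proof
  show "inj_on (\<lambda>(u, v). u \<circ> translation lam \<circ> v) (weyl_group \<times> min_reps lam)"
  proof (rule inj_onI, clarify)
    fix u v u' v'
    assume u: "u \<in> weyl_group" "u' \<in> weyl_group" and v: "v \<in> min_reps lam" "v' \<in> min_reps lam"
      and eq: "u \<circ> translation lam \<circ> v = u' \<circ> translation lam \<circ> v'"
    have lin: "linear u" "linear u'" "linear v" "linear v'"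
      using u v min_reps_weyl weyl_linear by auto
    have pt: "u (v x) + u lam = u' (v' x) + u' lam" for x
      using fun_cong [OF eq, of x] lin by (simp add: translation_def linear_add)
    have ulam: "u lam = u' lam" using pt [of 0] lin by (simp add: linear_0)
    then have uv: "u (v x) = u' (v' x)" for x using pt [of x] by simp
    define a where "a = inv u' \<circ> u"
    have "a lam = lam" by (simp add: a_def ulam weyl_cancel [OF u(2)])
    then have a: "a \<in> stabilizer lam"
      using weyl_comp [OF weyl_inv [OF u(2)] u(1)] by (simp add: stabilizer_def a_def)
    have av: "a \<circ> v = v'" by (simp add: a_def fun_eq_iff uv weyl_cancel [OF u(2)])
    then have "a = id" using min_rep_unique [OF lam a v(1)] v(2) by simp
    then have "v = v'" using av by simp_all
    moreover have "u' \<circ> a = u" by (simp add: a_def fun_eq_iff weyl_cancel [OF u(2)])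
    ultimately show "u = u' \<and> v = v'" using \<open>a = id\<close> by simp
  qed
  show "(\<lambda>(u, v). u \<circ> translation lam \<circ> v) ` (weyl_group \<times> min_reps lam) = double_coset lam"
  proof (intro equalityI subsetI)
    fix x assume "x \<in> double_coset lam"
    then obtain u w where u: "u \<in> weyl_group" and w: "w \<in> weyl_group" and x: "x = u \<circ> translation lam \<circ> w"
      by (auto simp: double_coset_def)
    obtain a v where a: "a \<in> stabilizer lam" and v: "v \<in> min_reps lam" and av: "w = a \<circ> v"
      using min_rep_exists [OF lam w] by blast
    have "translation lam \<circ> a = a \<circ> translation lam"
      using translation_weyl [OF stabilizer_weyl [OF a], of lam] stabilizer_fix [OF a] by simp
    then have "x = (u \<circ> a) \<circ> translation lam \<circ> v" by (simp only: x av comp_assoc [symmetric]) (simp only: comp_assoc)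
    then show "x \<in> (\<lambda>(u, v). u \<circ> translation lam \<circ> v) ` (weyl_group \<times> min_reps lam)"
      using weyl_comp [OF u stabilizer_weyl [OF a]] v by (intro image_eqI [of _ _ "(u \<circ> a, v)"]) auto
  qed (use min_reps_weyl in \<open>auto simp: double_coset_def\<close>)
qed

lemma finite_double_coset: "finite (double_coset lam)"
proof -
  have "double_coset lam = (\<lambda>(u, v). u \<circ> translation lam \<circ> v) ` (weyl_group \<times> weyl_group)"
    by (auto simp: double_coset_def)
  then show ?thesis using finite_weyl by simp
qed

lemma double_coset_affine: "lam \<in> weights \<Longrightarrow> double_coset lam \<subseteq> ext_affine_weyl_group"
  unfolding double_coset_def by (auto intro: affine_comp [OF affine_comp] weyl_affine translation_affine)

lemma double_coset_left: "w \<in> weyl_group \<Longrightarrow> x \<in> double_coset lam \<Longrightarrow> w \<circ> x \<in> double_coset lam"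
  unfolding double_coset_def using weyl_comp by (smt (verit) comp_assoc mem_Collect_eq)

lemma double_coset_right: "w \<in> weyl_group \<Longrightarrow> x \<in> double_coset lam \<Longrightarrow> x \<circ> w \<in> double_coset lam"
  unfolding double_coset_def using weyl_comp by (smt (verit) comp_assoc mem_Collect_eq)

text \<open>By \<open>length_double_coset\<close> the length of
  \<open>u \<circ> translation lam \<circ> v\<close> is at most that of \<open>u\<close> plus that
  of the translation, with equality for \<open>v = id\<close>; the maximum therefore has the longest
  \<open>u\<close>. Finiteness makes both occurrences of \<open>ARG_MAX\<close> genuine
  maxima.\<close>

lemma length_max_element:
  assumes lam: "lam \<in> dominant_weights"
  shows "affine_length (max_length_element lam)
    = weyl_length longest_element + affine_length (translation lam)"
proof -
  have l: "longest_element \<in> weyl_group" "weyl_length w \<le> weyl_length longest_element"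
    if "w \<in> weyl_group" for w
  proof -
    have "\<forall>y. y \<in> weyl_group \<longrightarrow> weyl_length y \<le> Max (weyl_length ` weyl_group)"
      using finite_weyl by simp
    then show "longest_element \<in> weyl_group" "weyl_length w \<le> weyl_length longest_element"
      using arg_max_nat_lemma [of "\<lambda>w. w \<in> weyl_group" id weyl_length
          "Max (weyl_length ` weyl_group) + 1"] weyl_id that
      by (auto simp: longest_element_def less_Suc_eq_le)
  qed
  have tx: "translation lam \<in> double_coset lam"
    unfolding double_coset_def using weyl_id by (fastforce intro: exI [of _ id])
  have m: "max_length_element lam \<in> double_coset lam"
    "x \<in> double_coset lam \<Longrightarrow> affine_length x \<le> affine_length (max_length_element lam)" for x
  proof -
    have "\<forall>y. y \<in> double_coset lam \<longrightarrow> affine_length y \<le> Max (affine_length ` double_coset lam)"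
      using finite_double_coset by simp
    then show "max_length_element lam \<in> double_coset lam"
      "x \<in> double_coset lam \<Longrightarrow> affine_length x \<le> affine_length (max_length_element lam)"
      using arg_max_nat_lemma [of "\<lambda>w. w \<in> double_coset lam" "translation lam" affine_length
          "Max (affine_length ` double_coset lam) + 1"] tx
      by (auto simp: max_length_element_def less_Suc_eq_le)
  qed
  have "max_length_element lam \<in> (\<lambda>(u, v). u \<circ> translation lam \<circ> v) ` (weyl_group \<times> min_reps lam)"
    using m(1) bij_betw_double_coset [OF lam] by (simp add: bij_betw_def)
  then obtain u v where uv: "u \<in> weyl_group" "v \<in> min_reps lam"
    "max_length_element lam = u \<circ> translation lam \<circ> v" by auto
  have "affine_length (max_length_element lam) \<le> weyl_length u + affine_length (translation lam)"
    using length_double_coset [OF lam uv(1,2)] uv(1) by (simp add: uv(3) weyl_length_eq)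
  also have "weyl_length u \<le> weyl_length longest_element" using l uv by blast
  finally have "affine_length (max_length_element lam)
    \<le> weyl_length longest_element + affine_length (translation lam)" by simp
  moreover have "longest_element \<circ> translation lam \<in> double_coset lam"
    using double_coset_left [OF l(1) tx] uv by blast
  then have "weyl_length longest_element + affine_length (translation lam)
      \<le> affine_length (max_length_element lam)"
    using m(2) length_double_coset [OF lam l(1) id_min_reps] weyl_length_eq [OF l(1)] uv by force
  ultimately show ?thesis by simp
qed

text \<open>The unique factorization \<open>w = a \<circ> v\<close> has additive lengths, so the sum
  factors. The quotient of two Poincare polynomials thereby becomes a sum of powers and lies in
  \<open>coeff_ring\<close>.\<close>

lemma poincare_min_reps:
  assumes lam: "lam \<in> dominant_weights"
  shows "poincare 0 t = poincare lam t * (\<Sum>v\<in>min_reps lam. t ^ weyl_length v)"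
proof -
  have "poincare 0 t = (\<Sum>x\<in>stabilizer lam \<times> min_reps lam. t ^ weyl_length (case x of (a, v) \<Rightarrow> a \<circ> v))"
    unfolding poincare_def stabilizer_0
    by (rule sum.reindex_bij_betw [OF bij_betw_stabilizer_min_reps [OF lam], symmetric])
  also have "\<dots> = (\<Sum>(a, v)\<in>stabilizer lam \<times> min_reps lam. t ^ weyl_length a * t ^ weyl_length v)"
    using stabilizer_weyl min_reps_weyl
    by (intro sum.cong) (auto simp: weyl_length_eq weyl_comp length_stabilizer_min_rep [OF lam] power_add)
  also have "\<dots> = poincare lam t * (\<Sum>v\<in>min_reps lam. t ^ weyl_length v)"
    by (simp add: poincare_def sum_product sum.cartesian_product)
  finally show ?thesis .
qed

section \<open>The coefficient ring\<close>

lemma stabilizer_nonempty: "stabilizer lam \<noteq> {}"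
  using id_stabilizer by auto

lemma poincare_q2_nonzero: "poincare 0 (hecke_q ^ 2) \<noteq> 0"
  unfolding poincare_def power_mult [symmetric]
  by (rule sum_hecke_q_power_nonzero [OF finite_stabilizer stabilizer_nonempty])

lemma hecke_q_powi_minus2: "(hecke_q powi (-2)) ^ n = inverse hecke_q ^ (2 * n)"
  by (simp add: power_int_minus power_mult power_inverse)

lemma poincare_q_minus2_nonzero: "poincare lam (hecke_q powi (-2)) \<noteq> 0"
  unfolding poincare_def hecke_q_powi_minus2
  by (rule sum_hecke_q_inverse_power_nonzero [OF finite_stabilizer stabilizer_nonempty])

lemma coeff_q: "hecke_q \<in> coeff_ring"
  and coeff_inverse_q: "inverse hecke_q \<in> coeff_ring"
  and coeff_inverse_poincare: "inverse (poincare 0 (hecke_q ^ 2)) \<in> coeff_ring"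
  and coeff_1: "1 \<in> coeff_ring"
  and coeff_diff: "a \<in> coeff_ring \<Longrightarrow> b \<in> coeff_ring \<Longrightarrow> a - b \<in> coeff_ring"
  and coeff_mult: "a \<in> coeff_ring \<Longrightarrow> b \<in> coeff_ring \<Longrightarrow> a * b \<in> coeff_ring"
  unfolding coeff_ring_def by (simp_all add: subring_generated.intros)

lemma coeff_0: "0 \<in> coeff_ring"
  using coeff_diff [OF coeff_1 coeff_1] by simp

lemma coeff_uminus: "a \<in> coeff_ring \<Longrightarrow> - a \<in> coeff_ring"
  using coeff_diff [OF coeff_0] by simp

lemma coeff_add: "a \<in> coeff_ring \<Longrightarrow> b \<in> coeff_ring \<Longrightarrow> a + b \<in> coeff_ring"
  using coeff_diff [OF _ coeff_uminus] by fastforce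

lemma coeff_power: "a \<in> coeff_ring \<Longrightarrow> a ^ n \<in> coeff_ring"
  by (induction n) (simp_all add: coeff_1 coeff_mult)

lemma coeff_q_powi: "hecke_q powi k \<in> coeff_ring"
  by (simp add: power_int_def coeff_power coeff_q coeff_inverse_q)

lemma coeff_sum: "(\<And>x. x \<in> S \<Longrightarrow> f x \<in> coeff_ring) \<Longrightarrow> sum f S \<in> coeff_ring"
  by (induction S rule: infinite_finite_induct) (simp_all add: coeff_0 coeff_add)

lemma coeff_poincare: "a \<in> coeff_ring \<Longrightarrow> poincare lam a \<in> coeff_ring"
  by (simp add: poincare_def coeff_sum coeff_power)

lemmas coeff_intros = coeff_q coeff_inverse_q coeff_inverse_poincare coeff_1 coeff_0 coeff_diff
  coeff_mult coeff_add coeff_power coeff_q_powi coeff_sum coeff_poincare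

end

section \<open>The affine reflection\<close>

context affine_root_datum
begin

text \<open>The coroot formed with the positive definite form. With \<open>B\<close> indefinite, the
  scalar in \<open>coroot B \<alpha>\<close> may be negative; here it is positive, so
  \<open>ht\<close> of this coroot detects positivity of the root.\<close>

definition inv_coroot :: "'a \<Rightarrow> 'a" where
  "inv_coroot \<alpha> = (2 / inv_form \<alpha> \<alpha>) *\<^sub>R \<alpha>"

lemma linear_inv_form_right: "linear (inv_form x)"
  by (simp add: linear_iff inv_form_add_right inv_form_scale_right)

lemma pairing_inv_coroot: "\<alpha> \<in> R \<Longrightarrow> pairing x \<alpha> = inv_form x (inv_coroot \<alpha>)"
  by (simp add: inv_coroot_def inv_form_scale_right pairing_eq)

lemma weyl_inv_coroot: "w \<in> weyl_group \<Longrightarrow> w (inv_coroot \<alpha>) = inv_coroot (w \<alpha>)"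
  by (simp add: inv_coroot_def inv_form_weyl linear_scale [OF weyl_linear])

lemma ht_inv_coroot: "\<alpha> \<in> R \<Longrightarrow> ht (inv_coroot \<alpha>) > 0 \<longleftrightarrow> \<alpha> \<in> Rp"
  using inv_form_root_pos [of \<alpha>] by (auto simp: inv_coroot_def ht_scale pos_iff zero_less_divide_iff)

lemma inv_coroot_inj:
  assumes "\<alpha> \<in> R" "\<beta> \<in> R" "inv_coroot \<alpha> = inv_coroot \<beta>"
  shows "\<alpha> = \<beta>"
proof -
  have pos: "inv_form \<alpha> \<alpha> > 0" "inv_form \<beta> \<beta> > 0" using assms inv_form_root_pos by auto
  define c where "c = inv_form \<alpha> \<alpha> / inv_form \<beta> \<beta>"
  have "c > 0" using pos by (simp add: c_def)
  have "\<alpha> = (inv_form \<alpha> \<alpha> / 2) *\<^sub>R inv_coroot \<alpha>" using pos by (simp add: inv_coroot_def)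
  also have "\<dots> = c *\<^sub>R \<beta>" unfolding assms(3) by (simp add: inv_coroot_def c_def)
  finally have "\<alpha> = c *\<^sub>R \<beta>" .
  then show ?thesis using reduced [OF assms(2), of c] assms(1) \<open>c > 0\<close> by auto
qed

lemma phi_root: "\<phi> \<in> R"
  using phi_positive by (rule pos_root)

text \<open>Both kinds of coroot represent the same functional, one through \<open>B\<close> and one
  through \<open>inv_form\<close>. Pairing the hypothesis on \<phi> with an arbitrary
  \<open>x\<close> and using definiteness transfers the relation with the same coefficients.\<close>

lemma highest_inv_coroot:
  assumes "\<alpha> \<in> Rp"
  obtains c :: "'a \<Rightarrow> nat"
  where "inv_coroot \<phi> - inv_coroot \<alpha> = (\<Sum>\<beta>\<in>simple_roots. real (c \<beta>) *\<^sub>R inv_coroot \<beta>)"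
proof -
  obtain c :: "'a \<Rightarrow> nat" where
    c: "coroot B \<phi> - coroot B \<alpha> = (\<Sum>\<beta>\<in>simple_roots. real (c \<beta>) *\<^sub>R coroot B \<beta>)"
    using phi_highest [OF assms] by blast
  let ?S = "\<Sum>\<beta>\<in>simple_roots. real (c \<beta>) *\<^sub>R inv_coroot \<beta>"
  let ?d = "inv_coroot \<phi> - inv_coroot \<alpha> - ?S"
  have "inv_form x ?d = 0" for x
  proof -
    have lin: "linear (B x)" using bilinear_form by (simp add: bilinear_def)
    note lin' = linear_inv_form_right [of x]
    have "inv_form x (inv_coroot \<phi> - inv_coroot \<alpha>) = B x (coroot B \<phi> - coroot B \<alpha>)"
      using pairing_inv_coroot [OF phi_root, of x] pairing_inv_coroot [OF pos_root [OF assms], of x]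
      by (simp add: pairing_def inv_form_diff_right linear_diff [OF lin])
    also have "\<dots> = (\<Sum>\<beta>\<in>simple_roots. real (c \<beta>) * pairing x \<beta>)"
      by (simp add: c linear_sum [OF lin] linear_scale [OF lin] pairing_def)
    also have "\<dots> = inv_form x ?S"
      by (simp add: linear_sum [OF lin'] linear_scale [OF lin'] pairing_inv_coroot simple_root)
    finally show ?thesis by (simp add: inv_form_diff_right)
  qed
  then have "?d = 0" using inv_form_eq_0 by blast
  then show thesis by (intro that [of c]) simp
qed

lemma ht_highest:
  assumes a: "\<alpha> \<in> Rp" and ne: "\<alpha> \<noteq> \<phi>"
  shows "ht (inv_coroot \<alpha>) < ht (inv_coroot \<phi>)"
proof -
  obtain c :: "'a \<Rightarrow> nat" where
    c: "inv_coroot \<phi> - inv_coroot \<alpha> = (\<Sum>\<beta>\<in>simple_roots. real (c \<beta>) *\<^sub>R inv_coroot \<beta>)"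
    using highest_inv_coroot [OF a] .
  have fin: "finite simple_roots" using finite_subset [OF _ finite_pos] simple_pos by blast
  have pos: "ht (inv_coroot \<beta>) > 0" if "\<beta> \<in> simple_roots" for \<beta>
    using ht_inv_coroot [OF simple_root [OF that]] simple_pos [OF that] by simp
  obtain \<gamma> where g: "\<gamma> \<in> simple_roots" "c \<gamma> \<noteq> 0"
  proof (rule ccontr)
    assume "\<not> thesis"
    then have "\<forall>\<gamma>\<in>simple_roots. c \<gamma> = 0" using that by blast
    then have "inv_coroot \<phi> = inv_coroot \<alpha>" using c by simp
    then show False using inv_coroot_inj [OF phi_root pos_root [OF a]] ne by blast
  qed
  then have "0 < (\<Sum>\<beta>\<in>simple_roots. real (c \<beta>) * ht (inv_coroot \<beta>))"
    using fin pos g by (intro sum_pos2 [OF fin g(1)]) (auto dest: less_imp_le [OF pos])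
  also have "\<dots> = ht (inv_coroot \<phi>) - ht (inv_coroot \<alpha>)"
    using arg_cong [OF c, of ht] by (simp add: ht_diff linear_sum [OF linear_ht] ht_scale)
  finally show ?thesis by simp
qed

text \<open>Reflecting the coroot of \<beta> subtracts a multiple of \<phi>. Symmetry of
  \<open>inv_form\<close> rewrites that multiple of \<phi> as \<open>pairing \<phi> \<beta>\<close>
  times the coroot of \<phi>.\<close>

lemma phi_reflection_coroot:
  assumes "\<beta> \<in> R"
  shows "inv_coroot (reflection B \<phi> \<beta>) = inv_coroot \<beta> - pairing \<phi> \<beta> *\<^sub>R inv_coroot \<phi>"
proof -
  have "inv_coroot (reflection B \<phi> \<beta>) = inv_coroot \<beta> - pairing (inv_coroot \<beta>) \<phi> *\<^sub>R \<phi>"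
    unfolding weyl_inv_coroot [OF reflection_in_weyl [OF phi_root], symmetric]
    by (rule reflection_pairing)
  moreover have "pairing (inv_coroot \<beta>) \<phi> *\<^sub>R \<phi> = pairing \<phi> \<beta> *\<^sub>R inv_coroot \<phi>"
    using pairing_inv_coroot [OF assms, of \<phi>]
    by (simp add: pairing_eq [OF phi_root] inv_form_sym [of "inv_coroot \<beta>" \<phi>] inv_coroot_def [of \<phi>])
  ultimately show ?thesis by simp
qed

text \<open>No coroot has \<open>ht\<close> above that of \<phi> in absolute value, while the coroot
  of \<beta> lies strictly between 0 and that bound. Subtracting \<open>m\<close> times the coroot
  of \<phi> must stay within the bound, which leaves \<open>m = 0\<close>, where \<beta> is fixed,
  and \<open>m = 1\<close>, where it turns negative.\<close>

lemma phi_pairing: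
  assumes b: "\<beta> \<in> Rp" "\<beta> \<noteq> \<phi>"
  shows "pairing \<phi> \<beta> = chi (reflection B \<phi> \<beta>)"
proof -
  let ?s = "reflection B \<phi>"
  have bR: "\<beta> \<in> R" using pos_root [OF b(1)] .
  have sR: "?s \<beta> \<in> R" using reflection_roots [OF phi_root bR] .
  obtain m where m: "pairing \<phi> \<beta> = of_int m"
    using pairing_root_int [OF bR phi_root] by (auto elim: Ints_cases)
  have ht: "ht (inv_coroot (?s \<beta>)) = ht (inv_coroot \<beta>) - m * ht (inv_coroot \<phi>)"
    by (simp add: phi_reflection_coroot [OF bR] m ht_diff ht_scale)
  have pos: "ht (inv_coroot \<beta>) > 0" "ht (inv_coroot \<phi>) > 0" "ht (inv_coroot \<beta>) < ht (inv_coroot \<phi>)"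
    using ht_inv_coroot bR phi_root phi_positive b ht_highest by auto
  have le: "ht (inv_coroot \<alpha>) \<le> ht (inv_coroot \<phi>)" if "\<alpha> \<in> Rp" for \<alpha>
    using ht_highest [OF that] by (cases "\<alpha> = \<phi>") auto
  have "m \<ge> 0"
  proof (rule ccontr)
    assume "\<not> ?thesis"
    then have "real_of_int m \<le> -1" by linarith
    then have "m * ht (inv_coroot \<phi>) \<le> -1 * ht (inv_coroot \<phi>)"
      using pos by (intro mult_right_mono) auto
    then have "ht (inv_coroot (?s \<beta>)) > ht (inv_coroot \<phi>)" using ht pos by linarith
    then show False using le [of "?s \<beta>"] ht_inv_coroot [OF sR] pos by linarith
  qed
  moreover have "m \<le> 1"
  proof (rule ccontr)
    assume "\<not> ?thesis"
    then have "real_of_int m \<ge> 2" by linarith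
    then have "m * ht (inv_coroot \<phi>) \<ge> 2 * ht (inv_coroot \<phi>)"
      using pos by (intro mult_right_mono) auto
    then have *: "- ht (inv_coroot (?s \<beta>)) > ht (inv_coroot \<phi>)" using ht pos by linarith
    have "inv_coroot (- ?s \<beta>) = - inv_coroot (?s \<beta>)"
      by (simp add: inv_coroot_def inv_form_neg inv_form_neg_right)
    then have "ht (inv_coroot (- ?s \<beta>)) > ht (inv_coroot \<phi>)" using * by (simp add: ht_neg)
    then show False using le [of "- ?s \<beta>"] ht_inv_coroot [OF uminus_root [OF sR]] pos by linarith
  qed
  ultimately consider "m = 0" | "m = 1" by linarith
  then show ?thesis
  proof cases
    case 1
    then have "pairing \<beta> \<phi> = 0"
      using m pairing_sgn(1) [OF bR, of \<phi>] pairing_sgn(1) [OF phi_root, of \<beta>]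
      by (simp add: inv_form_sym [of \<beta> \<phi>])
    then show ?thesis using m 1 b(1) by (simp add: reflection_pairing chi_pos)
  next
    case 2
    then have "?s \<beta> \<notin> Rp" using ht pos ht_inv_coroot [OF sR] by auto
    then show ?thesis using m 2 by (simp add: chi_not_pos)
  qed
qed

text \<open>The counterpart of \<open>chi_simple_reflection\<close> for \<open>s0\<close>: away from
  \<phi> and \<open>- \<phi>\<close>, the change of sign caused by the reflection is compensated by
  the pairing with the translation part.\<close>

lemma chi_phi_reflection:
  assumes "\<beta> \<in> R" "\<beta> \<noteq> \<phi>" "\<beta> \<noteq> - \<phi>"
  shows "chi (reflection B \<phi> \<beta>) = pairing \<phi> \<beta> + chi \<beta>"
proof (cases "\<beta> \<in> Rp")
  case True
  then show ?thesis using phi_pairing [of \<beta>] assms by (simp add: chi_pos)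
next
  case False
  then have "- \<beta> \<in> Rp" "- \<beta> \<noteq> \<phi>" using assms pos_uminus by auto
  then have "pairing \<phi> (- \<beta>) = chi (reflection B \<phi> (- \<beta>))" by (rule phi_pairing)
  then show ?thesis
    using False chi_uminus [OF reflection_roots [OF phi_root assms(1)]]
      weyl_neg [OF reflection_in_weyl [OF phi_root]]
    by (simp add: pairing_uminus_right chi_not_pos)
qed

lemma s0_affine: "s0 \<in> ext_affine_weyl_group"
  unfolding s0_def
  by (intro affine_comp translation_affine weyl_affine root_weight reflection_in_weyl phi_root)

lemma s0_s0: "s0 \<circ> s0 = id"
proof -
  have "translation \<phi> \<circ> (reflection B \<phi> \<circ> translation \<phi> \<circ> reflection B \<phi>) = id"
    using linear_add [OF linear_reflection]
    by (simp add: fun_eq_iff translation_def reflection_self [OF phi_root] reflection_involution [OF phi_root])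
  then show ?thesis by (simp only: s0_def comp_assoc)
qed

text \<open>The translation part becomes \<open>lam - inv w \<phi>\<close>, and only the summands at
  \<open>c = inv w \<phi>\<close> and its negative change. The pairing with \<open>c\<close> drops
  by 2 while \<open>chi\<close> rises by 1, so \<open>|m - chi c|\<close> becomes
  \<open>|m - chi c - 1|\<close>.\<close>

lemma length_s0_left:
  assumes w: "w \<in> weyl_group" and lam: "lam \<in> weights"
  shows "real (affine_length (s0 \<circ> (w \<circ> translation lam)))
    = real (affine_length (w \<circ> translation lam))
      + (if pairing lam (inv w \<phi>) - chi (inv w \<phi>) \<ge> 1 then -1 else 1)"
proof -
  let ?s = "reflection B \<phi>" and ?c = "inv w \<phi>"
  let ?m = "lam - ?c"
  have s: "?s \<in> weyl_group" using reflection_in_weyl [OF phi_root] .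
  have c: "?c \<in> R" using weyl_root [OF weyl_inv [OF w] phi_root] .
  have m: "?m \<in> weights" using add_weight [OF lam neg_weight [OF root_weight [OF c]]] by simp
  have sw: "?s \<circ> w \<in> weyl_group" using weyl_comp [OF s w] .
  have eq: "s0 \<circ> (w \<circ> translation lam) = (?s \<circ> w) \<circ> translation ?m"
    using linear_diff [OF linear_reflection, of \<phi>] linear_add [OF linear_reflection, of \<phi>]
      linear_diff [OF weyl_linear [OF w]] linear_add [OF weyl_linear [OF w]]
    by (simp add: fun_eq_iff weyl_cancel [OF w] s0_def translation_def reflection_self [OF phi_root])
  have val: "length_term (?s \<circ> w) ?m \<beta>
      = \<bar>pairing lam \<beta> - pairing \<phi> (w \<beta>) + chi (?s (w \<beta>)) - chi \<beta>\<bar>" for \<beta>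
    using pairing_inv_weyl [OF w, of \<phi> \<beta>] by (simp add: length_term_def pairing_diff)
  have "sum (length_term (?s \<circ> w) ?m) R = sum (length_term w lam) R
      + 2 * (length_term (?s \<circ> w) ?m ?c - length_term w lam ?c)"
  proof (rule sum_roots_change [OF c])
    fix \<beta> assume b: "\<beta> \<in> R" "\<beta> \<noteq> ?c" "\<beta> \<noteq> - ?c"
    have "w \<beta> \<noteq> \<phi>" "w \<beta> \<noteq> - \<phi>"
      using b w weyl_neg [OF w, of ?c] weyl_inv_f [OF w] by (metis, metis weyl_f_inv)
    then show "length_term (?s \<circ> w) ?m \<beta> = length_term w lam \<beta>"
      unfolding val using chi_phi_reflection [OF weyl_root [OF w b(1)]] by (simp add: length_term_def)
  qed (use length_term_uminus c w sw in auto)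
  moreover have "length_term (?s \<circ> w) ?m ?c - length_term w lam ?c
      = (if pairing lam ?c - chi ?c \<ge> 1 then -1 else 1)"
  proof -
    have "pairing lam ?c - chi ?c \<in> \<int>"
      using weight_pairing_int [OF lam c] by (auto simp: chi_def)
    from abs_Ints_minus_1 [OF this] show ?thesis
      unfolding val using chi_pos [OF phi_positive] chi_uminus [OF phi_root]
      by (simp add: length_term_def reflection_self [OF phi_root] pairing_self [OF phi_root] weyl_cancel [OF w] algebra_simps)
  qed
  ultimately show ?thesis
    unfolding eq using real_affine_length [OF w lam] real_affine_length [OF sw m] by simp
qed

lemma simple_reflection_affine: "s \<in> simple_reflections \<Longrightarrow> s \<in> ext_affine_weyl_group"
  and simple_reflection_involution: "s \<in> simple_reflections \<Longrightarrow> s \<circ> s = id"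
  unfolding simple_reflections_def
  using s0_affine s0_s0 weyl_affine [OF reflection_in_weyl [OF simple_root]]
    reflection_comp_self [OF simple_root] by auto

lemma length_simple_reflection_cases:
  assumes "x \<in> ext_affine_weyl_group" and "s \<in> simple_reflections"
  shows "affine_length (s \<circ> x) = affine_length x + 1 \<or> affine_length x = affine_length (s \<circ> x) + 1"
proof (cases "s = s0")
  case True
  show ?thesis
    using assms(1) by (rule affine_groupE) (use length_s0_left True in \<open>force split: if_splits\<close>)
next
  case False
  then show ?thesis
    using assms length_simple_left_cases by (auto simp: simple_reflections_def)
qed

text \<open>Write \<open>x\<close> as the translation by \<open>\<mu> = w lam\<close> after
  \<open>w\<close>. The absence of descents at simple roots makes \<mu> dominant and keeps
  \<open>inv w\<close> positive on simple roots orthogonal to \<mu>; the absence of a descent at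
  \<open>s0\<close> bounds the pairing of \<mu> with \<phi>. Together they force the pairing with
  each positive \<beta> to equal \<open>chi (inv w \<beta>)\<close>, so every length summand
  vanishes. Such an \<open>x\<close> preserves the fundamental alcove.\<close>

lemma no_descent_length_0:
  assumes x: "x \<in> ext_affine_weyl_group"
    and no_descent: "\<And>s. s \<in> simple_reflections \<Longrightarrow> \<not> affine_length (s \<circ> x) < affine_length x"
  shows "affine_length x = 0"
proof -
  obtain w lam where w: "w \<in> weyl_group" and lam: "lam \<in> weights" and xw: "x = w \<circ> translation lam"
    using x by (rule affine_groupE)
  let ?v = "inv w"
  have v: "?v \<in> weyl_group" using weyl_inv [OF w] .
  define \<mu> where "\<mu> = w lam"
  have \<mu>: "pairing lam (?v \<beta>) = pairing \<mu> \<beta>" for \<beta> using pairing_weyl [OF w] by (simp add: \<mu>_def)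
  have \<mu>P: "\<mu> \<in> weights" using weyl_weight [OF w lam] by (simp add: \<mu>_def)
  have simple: "pairing \<mu> \<alpha> \<ge> chi (?v \<alpha>)" if "\<alpha> \<in> simple_roots" for \<alpha>
    using length_simple_left [OF w lam that] no_descent [of "reflection B \<alpha>"] that xw \<mu>
    by (auto simp: simple_reflections_def split: if_splits)
  have phi: "pairing \<mu> \<phi> - chi (?v \<phi>) < 1"
    using length_s0_left [OF w lam] no_descent [of s0] xw \<mu>
    by (auto simp: simple_reflections_def split: if_splits)
  have dom: "pairing \<mu> \<alpha> \<ge> 0" "pairing \<mu> \<alpha> = 0 \<Longrightarrow> ?v \<alpha> \<in> Rp" if "\<alpha> \<in> simple_roots" for \<alpha>
    using simple [OF that] by (auto simp: chi_def split: if_splits)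
  have key: "pairing \<mu> \<beta> = chi (?v \<beta>)" if b: "\<beta> \<in> Rp" for \<beta>
  proof -
    have bR: "\<beta> \<in> R" using pos_root [OF b] .
    have ge: "pairing \<mu> \<beta> \<ge> 0" by (rule dominant_on_pos(1) [OF _ v _ b]) (fact dom)+
    have zero: "?v \<beta> \<in> Rp" if "pairing \<mu> \<beta> = 0"
      by (rule dominant_on_pos(2) [OF _ v _ b that]) (fact dom)+
    obtain k where k: "pairing \<mu> \<beta> = of_int k" using weight_pairing_int [OF \<mu>P bR] by (auto elim: Ints_cases)
    obtain l where l: "pairing \<mu> \<phi> = of_int l" using weight_pairing_int [OF \<mu>P phi_root] by (auto elim: Ints_cases)
    obtain c :: "'a \<Rightarrow> nat" where
      c: "inv_coroot \<phi> - inv_coroot \<beta> = (\<Sum>\<alpha>\<in>simple_roots. real (c \<alpha>) *\<^sub>R inv_coroot \<alpha>)"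
      using highest_inv_coroot [OF b] .
    have fin: "finite simple_roots" using finite_subset [OF _ finite_pos] simple_pos by blast
    note lin' = linear_inv_form_right [of \<mu>]
    have diff: "pairing \<mu> \<phi> - pairing \<mu> \<beta> = (\<Sum>\<alpha>\<in>simple_roots. real (c \<alpha>) * pairing \<mu> \<alpha>)"
      using arg_cong [OF c, of "inv_form \<mu>"]
      by (simp add: linear_sum [OF lin'] linear_scale [OF lin'] linear_diff [OF lin']
          pairing_inv_coroot simple_root phi_root bR)
    have nonneg: "real (c \<alpha>) * pairing \<mu> \<alpha> \<ge> 0" if "\<alpha> \<in> simple_roots" for \<alpha>
      using dom(1) [OF that] by simp
    show ?thesis
    proof (cases "k = 0")
      case True
      then have "pairing \<mu> \<beta> = 0" using k by simp
      then show ?thesis using chi_pos [OF zero] by simp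
    next
      case False
      then have k1: "k \<ge> 1" using ge k by simp
      \<comment> \<open>Integers squeezed by
        \<open>1 \<le> k \<le> l < 1 + chi (?v \<phi>) \<le> 2\<close>, hence all equalities claimed
        below.\<close>
      have "k \<le> l" using diff sum_nonneg [of simple_roots "\<lambda>\<alpha>. real (c \<alpha>) * pairing \<mu> \<alpha>"] nonneg k l by simp
      moreover have "real_of_int l - chi (?v \<phi>) < 1" using phi l by simp
      ultimately have k: "pairing \<mu> \<beta> = 1" "pairing \<mu> \<phi> = 1" and neg: "chi (?v \<phi>) = 1"
        using k1 k l chi_cases [of "?v \<phi>"] by auto
      \<comment> \<open>As \<phi> and \<beta> pair equally with \<mu>, only simple coroots
        orthogonal to \<mu> occur in the difference of their coroots. \<open>?v\<close> keeps those
        positive, so the image of the coroot of \<beta> lies no higher than that of \<phi>, which is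
        negative.\<close>
      have "\<forall>\<alpha>\<in>simple_roots. real (c \<alpha>) * pairing \<mu> \<alpha> = 0"
        using sum_nonneg_eq_0_iff [OF fin nonneg] diff k by simp
      then have pos: "real (c \<alpha>) * ht (inv_coroot (?v \<alpha>)) \<ge> 0" if "\<alpha> \<in> simple_roots" for \<alpha>
      proof (cases "c \<alpha> = 0")
        case False
        then have "?v \<alpha> \<in> Rp" using \<open>\<forall>\<alpha>\<in>simple_roots. real (c \<alpha>) * pairing \<mu> \<alpha> = 0\<close> that by (intro dom(2)) auto
        then show ?thesis using ht_inv_coroot [OF weyl_root [OF v simple_root [OF that]]] by simp
      qed simp
      have "ht (?v (inv_coroot \<phi> - inv_coroot \<beta>)) \<ge> 0"
        unfolding c
        by (simp add: linear_sum [OF weyl_linear [OF v]] linear_scale [OF weyl_linear [OF v]]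
            linear_sum [OF linear_ht] ht_scale weyl_inv_coroot [OF v] sum_nonneg pos)
      then have "ht (inv_coroot (?v \<beta>)) \<le> ht (inv_coroot (?v \<phi>))"
        by (simp add: linear_diff [OF weyl_linear [OF v]] ht_diff weyl_inv_coroot [OF v])
      moreover have "?v \<phi> \<notin> Rp" using neg by (auto simp: chi_def split: if_splits)
      ultimately have "?v \<beta> \<notin> Rp"
        using ht_inv_coroot [OF weyl_root [OF v bR]] ht_inv_coroot [OF weyl_root [OF v phi_root]] by linarith
      then show ?thesis using k by (simp add: chi_not_pos)
    qed
  qed
  have key': "length_term w lam (?v \<beta>) = 0" if "\<beta> \<in> R" for \<beta>
  proof (cases "\<beta> \<in> Rp")
    case True
    then show ?thesis using key [OF True] by (simp add: length_term_def \<mu> chi_pos weyl_cancel [OF w])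
  next
    case False
    then have "- \<beta> \<in> Rp" using that pos_uminus by blast
    then have "length_term w lam (?v (- \<beta>)) = 0"
      using key [of "- \<beta>"] by (simp add: length_term_def \<mu> chi_pos weyl_cancel [OF w])
    then show ?thesis
      using length_term_uminus [OF w weyl_root [OF v that]] weyl_neg [OF v] by simp
  qed
  have "sum (length_term w lam) R = (\<Sum>\<beta>\<in>R. length_term w lam (?v \<beta>))"
    by (rule sum.reindex_bij_betw [OF weyl_bij_betw_roots [OF v], symmetric])
  also have "\<dots> = 0" using key' by simp
  finally show ?thesis using real_affine_length [OF w lam] xw by simp
qed

end

section \<open>The affine Hecke algebra\<close>

context affine_hecke_algebra
begin

lemma smul_0_left: "smul 0 x = 0"
  using smul_add_left [OF coeff_0 coeff_0, of x] by simp

lemma smul_0_right: "a \<in> coeff_ring \<Longrightarrow> smul a 0 = 0"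
  using smul_add_right [of a 0 0] by simp

lemma smul_sum_right: "a \<in> coeff_ring \<Longrightarrow> smul a (sum f S) = (\<Sum>x\<in>S. smul a (f x))"
  by (induction S rule: infinite_finite_induct) (simp_all add: smul_0_right smul_add_right)

lemma smul_sum_left:
  "(\<And>x. x \<in> S \<Longrightarrow> f x \<in> coeff_ring) \<Longrightarrow> smul (sum f S) h = (\<Sum>x\<in>S. smul (f x) h)"
  by (induction S rule: infinite_finite_induct) (simp_all add: smul_0_left smul_add_left coeff_sum)

text \<open>The unit is not given as a basis element. Since \<open>id\<close> has length 0, left
  multiplication by \<open>T id\<close> fixes each \<open>T w\<close>, hence also the expansion of 1
  in the basis.\<close>

lemma T_id: "T id = 1"
proof -
  have idx: "id \<in> ext_affine_weyl_group" by (rule weyl_affine [OF weyl_id])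
  obtain c where c: "{w. c w \<noteq> 0} \<subseteq> ext_affine_weyl_group" "range c \<subseteq> coeff_ring"
    "1 = (\<Sum>w | c w \<noteq> 0. smul (c w) (T w))"
    using T_basis [of 1] by auto
  have "T id * 1 = (\<Sum>w | c w \<noteq> 0. T id * smul (c w) (T w))"
    by (subst c(3)) (simp add: sum_distrib_left)
  also have "\<dots> = (\<Sum>w | c w \<noteq> 0. smul (c w) (T w))"
  proof (rule sum.cong [OF refl])
    fix w assume "w \<in> {w. c w \<noteq> 0}"
    then have "w \<in> ext_affine_weyl_group" using c by blast
    then have "T id * T w = T w" using T_mult [OF idx, of w] by simp
    moreover have "c w \<in> coeff_ring" using c by blast
    ultimately show "T id * smul (c w) (T w) = smul (c w) (T w)" by (simp add: smul_mult_right)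
  qed
  also have "\<dots> = 1" using c(3) by (rule sym)
  finally show ?thesis by simp
qed

lemma length_simple_reflection:
  assumes "s \<in> simple_reflections" shows "affine_length s = 1"
  using length_simple_reflection_cases [OF weyl_affine [OF weyl_id] assms] by simp

lemma simple_reflectionsI: "\<alpha> \<in> simple_roots \<Longrightarrow> reflection B \<alpha> \<in> simple_reflections"
  by (simp add: simple_reflections_def)

section \<open>Multiplication by simple reflections and invertibility\<close>

lemma T_simple_mult:
  assumes s: "s \<in> simple_reflections" and x: "x \<in> ext_affine_weyl_group"
  shows "T s * T x = (if affine_length (s \<circ> x) < affine_length x
    then smul (hecke_q - inverse hecke_q) (T x) + T (s \<circ> x) else T (s \<circ> x))"
  using T_quadratic [OF s x] T_mult [OF simple_reflection_affine [OF s] x]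
    length_simple_reflection_cases [OF x s] length_simple_reflection [OF s] by auto

lemma T_simple_square:
  assumes s: "s \<in> simple_reflections"
  shows "T s * T s = smul (hecke_q - inverse hecke_q) (T s) + 1"
proof -
  have "affine_length (s \<circ> s) < affine_length s"
    unfolding simple_reflection_involution [OF s] length_simple_reflection [OF s] by simp
  then show ?thesis
    using T_quadratic [OF s simple_reflection_affine [OF s]]
    by (simp only: simple_reflection_involution [OF s] T_id)
qed

text \<open>The quadratic relation is given for left multiplication. When \<open>x \<circ> s\<close>
  is shorter than \<open>x\<close>, factoring \<open>T x = T (x \<circ> s) * T s\<close> reduces the
  right-hand version to the square of \<open>T s\<close>.\<close>

lemma T_mult_simple:
  assumes a: "\<alpha> \<in> simple_roots" and x: "x \<in> ext_affine_weyl_group"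
  shows "T x * T (reflection B \<alpha>) = (if affine_length (x \<circ> reflection B \<alpha>) < affine_length x
    then smul (hecke_q - inverse hecke_q) (T x) + T (x \<circ> reflection B \<alpha>)
    else T (x \<circ> reflection B \<alpha>))"
proof -
  let ?s = "reflection B \<alpha>"
  have s: "?s \<in> simple_reflections" using simple_reflectionsI [OF a] .
  have up: "T y * T ?s = T (y \<circ> ?s)"
    if "y \<in> ext_affine_weyl_group" "affine_length (y \<circ> ?s) = affine_length y + 1" for y
    using T_mult [OF that(1) simple_reflection_affine [OF s]] that(2) length_simple_reflection [OF s]
    by simp
  consider "affine_length (x \<circ> ?s) = affine_length x + 1" | "affine_length x = affine_length (x \<circ> ?s) + 1"
    using length_simple_right_cases [OF x a] by blast
  then show ?thesis
  proof cases
    case 1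
    then show ?thesis using up [OF x] by simp
  next
    case 2
    have xs: "x \<circ> ?s \<in> ext_affine_weyl_group" using affine_comp [OF x simple_reflection_affine [OF s]] .
    have xss: "x \<circ> ?s \<circ> ?s = x" by (simp only: comp_assoc simple_reflection_involution [OF s] comp_id)
    have Tx: "T x = T (x \<circ> ?s) * T ?s" using up [OF xs] 2 by (simp only: xss)
    have "T x * T ?s = T (x \<circ> ?s) * (T ?s * T ?s)" by (subst Tx) (simp add: mult.assoc)
    also have "\<dots> = smul (hecke_q - inverse hecke_q) (T x) + T (x \<circ> ?s)"
      by (simp only: T_simple_square [OF s] distrib_left mult_1_right)
        (simp add: smul_mult_right coeff_intros Tx [symmetric])
    finally show ?thesis using 2 by simp
  qed
qed

lemma T_simple_invertible:
  assumes s: "s \<in> simple_reflections"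
  shows "\<exists>b. T s * b = 1 \<and> b * T s = 1"
proof (intro exI conjI)
  let ?b = "T s - smul (hecke_q - inverse hecke_q) 1"
  show "T s * ?b = 1" "?b * T s = 1"
    using T_simple_square [OF s]
    by (simp_all add: right_diff_distrib left_diff_distrib smul_mult_left smul_mult_right coeff_intros)
qed

lemma invertible_mult:
  fixes a b :: 'h
  assumes "\<exists>a'. a * a' = 1 \<and> a' * a = 1" and "\<exists>b'. b * b' = 1 \<and> b' * b = 1"
  shows "\<exists>c. (a * b) * c = 1 \<and> c * (a * b) = 1"
proof -
  obtain a' b' where *: "a * a' = 1" "a' * a = 1" "b * b' = 1" "b' * b = 1" using assms by blast
  have "(a * b) * (b' * a') = a * (b * b') * a'" "(b' * a') * (a * b) = b' * (a' * a) * b"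
    by (simp_all only: mult.assoc)
  then show ?thesis using * by (intro exI [of _ "b' * a'"]) simp
qed

text \<open>Peeling off a shortening simple reflection writes \<open>T x\<close> as a product of an
  invertible element and a basis element of smaller length. When no such reflection exists,
  \<open>x\<close> has length 0, as does its inverse, and the two basis elements multiply to
  \<open>T id\<close>.\<close>

lemma T_invertible: "x \<in> ext_affine_weyl_group \<Longrightarrow> \<exists>b. T x * b = 1 \<and> b * T x = 1"
proof (induction "affine_length x" arbitrary: x rule: less_induct)
  case less
  show ?case
  proof (cases "\<exists>s\<in>simple_reflections. affine_length (s \<circ> x) < affine_length x")
    case True
    then obtain s where s: "s \<in> simple_reflections" "affine_length (s \<circ> x) < affine_length x" by blast
    have sx: "s \<circ> x \<in> ext_affine_weyl_group"
      using affine_comp [OF simple_reflection_affine [OF s(1)] less.prems] .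
    have ssx: "s \<circ> (s \<circ> x) = x"
      by (simp only: comp_assoc [symmetric] simple_reflection_involution [OF s(1)] id_comp)
    have "T s * T (s \<circ> x) = T (s \<circ> (s \<circ> x))"
      using T_simple_mult [OF s(1) sx] s(2) unfolding ssx by simp
    then have "T x = T s * T (s \<circ> x)" by (simp only: ssx)
    then show ?thesis
      using invertible_mult [OF T_simple_invertible [OF s(1)] less.hyps [OF s(2) sx]] by simp
  next
    case False
    then have 0: "affine_length x = 0" using no_descent_length_0 [OF less.prems] by blast
    obtain y where y: "y \<in> ext_affine_weyl_group" "x \<circ> y = id" "y \<circ> x = id"
      "affine_length y = affine_length x" using affine_inverse [OF less.prems] .
    have "affine_length (x \<circ> y) = affine_length x + affine_length y"
      "affine_length (y \<circ> x) = affine_length y + affine_length x"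
      unfolding y(2,3) by (simp_all add: 0 y(4))
    then have "T x * T y = 1" "T y * T x = 1"
      using T_mult [OF less.prems y(1)] T_mult [OF y(1) less.prems] by (simp_all only: y(2,3) T_id)
    then show ?thesis by blast
  qed
qed

lemma ring_inverse_right:
  fixes a :: 'h
  assumes "\<exists>b. a * b = 1 \<and> b * a = 1"
  shows "a * ring_inverse a = 1"
proof -
  obtain b where b: "a * b = 1" "b * a = 1" using assms by blast
  have "c = b" if "a * c = 1 \<and> c * a = 1" for c
  proof -
    have "c = (b * a) * c" by (simp only: b mult_1_left)
    also have "\<dots> = b * (a * c)" by (rule mult.assoc)
    finally show ?thesis using that by simp
  qed
  then have "ring_inverse a = b" unfolding ring_inverse_def using b by (intro the_equality) blast+
  then show ?thesis using b by simp
qed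

text \<open>\<open>(lam, 0)\<close> only shows that a decomposition exists; \<open>SOME\<close> may
  return any \<open>(\<mu>, \<nu>)\<close>. As \<open>\<mu> = lam + \<nu>\<close> with
  \<open>lam\<close> and \<nu> dominant, lengths add, and the factor
  \<open>T (translation \<nu>)\<close> cancels.\<close>

lemma x_elem_dominant:
  assumes lam: "lam \<in> dominant_weights"
  shows "x_elem lam = T (translation lam)"
proof -
  define Q where "Q = (\<lambda>(\<mu>, \<nu>). \<mu> \<in> dominant_weights \<and> \<nu> \<in> dominant_weights \<and> lam = \<mu> - \<nu>)"
  have "0 \<in> dominant_weights"
    using zero_weight by (simp add: dominant_weights_def pairing_def [symmetric] pairing_0)
  then have "Q (lam, 0)" using lam by (simp add: Q_def)
  then have "Q (Eps Q)" by (rule someI)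
  moreover obtain \<mu> \<nu> where p: "Eps Q = (\<mu>, \<nu>)" by (cases "Eps Q")
  ultimately have \<mu>\<nu>: "\<nu> \<in> dominant_weights" "\<mu> = lam + \<nu>" by (auto simp: Q_def)
  have t: "translation lam \<in> ext_affine_weyl_group" "translation \<nu> \<in> ext_affine_weyl_group"
    using translation_affine dominant_weight lam \<mu>\<nu>(1) by auto
  have "T (translation \<mu>) = T (translation lam) * T (translation \<nu>)"
    using T_mult [OF t] length_translation_add [OF lam \<mu>\<nu>(1)] by (simp only: \<mu>\<nu>(2) translation_add)
  then have "T (translation \<mu>) * ring_inverse (T (translation \<nu>)) = T (translation lam)"
    using ring_inverse_right [OF T_invertible [OF t(2)]] by (simp only: mult.assoc mult_1_right)
  then show ?thesis by (simp add: x_elem_def Q_def [symmetric] p)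
qed

section \<open>Sums over sets closed under the Weyl group\<close>

text \<open>Gives \<open>E\<close> for the Weyl group and \<open>S\<close> for a double coset, so
  that one eigenvalue computation serves both.\<close>

definition weighted_sum :: "('a \<Rightarrow> 'a) set \<Rightarrow> 'h" where
  "weighted_sum X = (\<Sum>x\<in>X. smul (hecke_q ^ affine_length x) (T x))"

lemma involution_bij_betw:
  "(\<And>x. x \<in> X \<Longrightarrow> f x \<in> X) \<Longrightarrow> (\<And>x. f (f x) = x) \<Longrightarrow> bij_betw f X X"
  by (rule bij_betwI [of _ _ _ f]) auto

text \<open>
  The coefficient of \<open>T y\<close> in the product with \<open>T s\<close> collects the contributions of \<open>y\<close> and of
  its partner \<open>s y\<close> (or \<open>y s\<close>).
\<close>

lemma smul_pair:
  assumes "k = n + 1 \<or> n = k + 1"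
  shows "smul (hecke_q ^ k) h
      + (if k < n then smul (hecke_q ^ n) (smul (hecke_q - inverse hecke_q) h) else 0)
    = smul hecke_q (smul (hecke_q ^ n) h)"
proof (cases "k < n")
  case True
  then have n: "n = k + 1" using assms by linarith
  have "hecke_q ^ k + hecke_q ^ n * (hecke_q - inverse hecke_q) = hecke_q * hecke_q ^ n"
    by (simp add: n field_simps)
  then show ?thesis
    using True by (simp add: smul_smul [symmetric] smul_add_left [symmetric] coeff_intros)
next
  case False
  then have "k = n + 1" using assms by linarith
  then show ?thesis by (simp add: smul_smul coeff_intros)
qed

lemma weighted_sum_simple_left:
  assumes X: "X \<subseteq> ext_affine_weyl_group" and a: "\<alpha> \<in> simple_roots"
    and closed: "\<And>x. x \<in> X \<Longrightarrow> reflection B \<alpha> \<circ> x \<in> X"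
  shows "T (reflection B \<alpha>) * weighted_sum X = smul hecke_q (weighted_sum X)"
proof -
  let ?s = "reflection B \<alpha>" and ?l = affine_length
  \<comment> \<open>The extra term of the quadratic relation, present only when the reflection
    shortens \<open>x\<close>.\<close>
  let ?d = "\<lambda>x. if ?l (?s \<circ> x) < ?l x
    then smul (hecke_q ^ ?l x) (smul (hecke_q - inverse hecke_q) (T x)) else 0"
  have ss: "?s \<circ> (?s \<circ> x) = x" for x :: "'a \<Rightarrow> 'a"
    by (simp only: comp_assoc [symmetric] reflection_comp_self [OF simple_root [OF a]] id_comp)
  have "T ?s * weighted_sum X = (\<Sum>x\<in>X. smul (hecke_q ^ ?l x) (T ?s * T x))"
    by (simp add: weighted_sum_def sum_distrib_left smul_mult_right coeff_intros)
  also have "\<dots> = (\<Sum>x\<in>X. smul (hecke_q ^ ?l x) (T (?s \<circ> x)) + ?d x)"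
    using X T_simple_mult [OF simple_reflectionsI [OF a]]
    by (intro sum.cong) (auto simp: smul_add_right coeff_intros add.commute)
  also have "\<dots> = (\<Sum>x\<in>X. smul (hecke_q ^ ?l x) (T (?s \<circ> x))) + sum ?d X"
    by (rule sum.distrib)
  \<comment> \<open>Reindexing by the partner makes both contributions multiples of the same
    \<open>T x\<close>, as \<open>smul_pair\<close> expects.\<close>
  also have "(\<Sum>x\<in>X. smul (hecke_q ^ ?l x) (T (?s \<circ> x)))
      = (\<Sum>x\<in>X. smul (hecke_q ^ ?l (?s \<circ> x)) (T x))"
    using sum.reindex_bij_betw [OF involution_bij_betw [of X "\<lambda>x. ?s \<circ> x", OF closed ss],
        of "\<lambda>x. smul (hecke_q ^ ?l (?s \<circ> x)) (T x)"]
    by (simp only: ss)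
  also have "\<dots> + sum ?d X = (\<Sum>x\<in>X. smul (hecke_q ^ ?l (?s \<circ> x)) (T x) + ?d x)"
    by (rule sum.distrib [symmetric])
  also have "\<dots> = (\<Sum>x\<in>X. smul hecke_q (smul (hecke_q ^ ?l x) (T x)))"
    using X length_simple_left_cases [OF _ a] by (intro sum.cong [OF refl] smul_pair) auto
  finally show ?thesis by (simp add: weighted_sum_def smul_sum_right coeff_intros)
qed

lemma weighted_sum_simple_right:
  assumes X: "X \<subseteq> ext_affine_weyl_group" and a: "\<alpha> \<in> simple_roots"
    and closed: "\<And>x. x \<in> X \<Longrightarrow> x \<circ> reflection B \<alpha> \<in> X"
  shows "weighted_sum X * T (reflection B \<alpha>) = smul hecke_q (weighted_sum X)"
proof -
  let ?s = "reflection B \<alpha>" and ?l = affine_length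
  let ?d = "\<lambda>x. if ?l (x \<circ> ?s) < ?l x
    then smul (hecke_q ^ ?l x) (smul (hecke_q - inverse hecke_q) (T x)) else 0"
  have ss: "(x \<circ> ?s) \<circ> ?s = x" for x :: "'a \<Rightarrow> 'a"
    by (simp only: comp_assoc reflection_comp_self [OF simple_root [OF a]] comp_id)
  have "weighted_sum X * T ?s = (\<Sum>x\<in>X. smul (hecke_q ^ ?l x) (T x * T ?s))"
    by (simp add: weighted_sum_def sum_distrib_right smul_mult_left coeff_intros)
  also have "\<dots> = (\<Sum>x\<in>X. smul (hecke_q ^ ?l x) (T (x \<circ> ?s)) + ?d x)"
    using X T_mult_simple [OF a]
    by (intro sum.cong) (auto simp: smul_add_right coeff_intros add.commute)
  also have "\<dots> = (\<Sum>x\<in>X. smul (hecke_q ^ ?l x) (T (x \<circ> ?s))) + sum ?d X"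
    by (rule sum.distrib)
  also have "(\<Sum>x\<in>X. smul (hecke_q ^ ?l x) (T (x \<circ> ?s)))
      = (\<Sum>x\<in>X. smul (hecke_q ^ ?l (x \<circ> ?s)) (T x))"
    using sum.reindex_bij_betw [OF involution_bij_betw [of X "\<lambda>x. x \<circ> ?s", OF closed ss],
        of "\<lambda>x. smul (hecke_q ^ ?l (x \<circ> ?s)) (T x)"]
    by (simp only: ss)
  also have "\<dots> + sum ?d X = (\<Sum>x\<in>X. smul (hecke_q ^ ?l (x \<circ> ?s)) (T x) + ?d x)"
    by (rule sum.distrib [symmetric])
  also have "\<dots> = (\<Sum>x\<in>X. smul hecke_q (smul (hecke_q ^ ?l x) (T x)))"
    using X length_simple_right_cases [OF _ a] by (intro sum.cong [OF refl] smul_pair) auto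
  finally show ?thesis by (simp add: weighted_sum_def smul_sum_right coeff_intros)
qed

lemma weighted_sum_left:
  assumes X: "X \<subseteq> ext_affine_weyl_group"
    and closed: "\<And>w x. w \<in> weyl_group \<Longrightarrow> x \<in> X \<Longrightarrow> w \<circ> x \<in> X"
    and w: "w \<in> weyl_group"
  shows "T w * weighted_sum X = smul (hecke_q ^ affine_length w) (weighted_sum X)"
  using w
proof (induction rule: weyl_induct_left)
  case id
  show ?case unfolding T_id length_id by (simp add: smul_one)
next
  case (step w \<alpha>)
  let ?s = "reflection B \<alpha>"
  have s: "?s \<in> simple_reflections" using simple_reflectionsI [OF step(2)] .
  have len: "affine_length (?s \<circ> w) = Suc (affine_length w)"
    using length_weyl_left [OF step(1,2)] step(3) by simp
  have "T (?s \<circ> w) = T ?s * T w"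
    using T_simple_mult [OF s weyl_affine [OF step(1)]] len by simp
  then have "T (?s \<circ> w) * weighted_sum X = T ?s * smul (hecke_q ^ affine_length w) (weighted_sum X)"
    using step(4) by (simp add: mult.assoc)
  also have "\<dots> = smul (hecke_q ^ affine_length w) (smul hecke_q (weighted_sum X))"
    using weighted_sum_simple_left [OF X step(2)] closed reflection_in_weyl [OF simple_root [OF step(2)]]
    by (simp add: smul_mult_right coeff_intros)
  also have "\<dots> = smul (hecke_q ^ affine_length (?s \<circ> w)) (weighted_sum X)"
    unfolding len by (simp add: smul_smul [symmetric] coeff_intros mult.commute)
  finally show ?case .
qed

lemma weighted_sum_right:
  assumes X: "X \<subseteq> ext_affine_weyl_group"
    and closed: "\<And>w x. w \<in> weyl_group \<Longrightarrow> x \<in> X \<Longrightarrow> x \<circ> w \<in> X"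
    and w: "w \<in> weyl_group"
  shows "weighted_sum X * T w = smul (hecke_q ^ affine_length w) (weighted_sum X)"
  using w
proof (induction rule: weyl_induct_right)
  case id
  show ?case unfolding T_id length_id by (simp add: smul_one)
next
  case (step w \<alpha>)
  let ?s = "reflection B \<alpha>"
  have len: "affine_length (w \<circ> ?s) = Suc (affine_length w)"
    using length_weyl_right [OF step(1,2)] step(3) by simp
  have "T (w \<circ> ?s) = T w * T ?s"
    using T_mult_simple [OF step(2) weyl_affine [OF step(1)]] len by simp
  then have "weighted_sum X * T (w \<circ> ?s) = smul (hecke_q ^ affine_length w) (weighted_sum X) * T ?s"
    using step(4) by (simp add: mult.assoc [symmetric])
  also have "\<dots> = smul (hecke_q ^ affine_length w) (smul hecke_q (weighted_sum X))"
    using weighted_sum_simple_right [OF X step(2)] closed reflection_in_weyl [OF simple_root [OF step(2)]]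
    by (simp add: smul_mult_left coeff_intros)
  also have "\<dots> = smul (hecke_q ^ affine_length (w \<circ> ?s)) (weighted_sum X)"
    unfolding len by (simp add: smul_smul [symmetric] coeff_intros mult.commute)
  finally show ?case .
qed

lemma weighted_sum_mult_weyl:
  assumes X: "X \<subseteq> ext_affine_weyl_group"
    and closed: "\<And>w x. w \<in> weyl_group \<Longrightarrow> x \<in> X \<Longrightarrow> x \<circ> w \<in> X"
  shows "weighted_sum X * weighted_sum weyl_group = smul (poincare 0 (hecke_q ^ 2)) (weighted_sum X)"
proof -
  have "weighted_sum X * weighted_sum weyl_group
    = (\<Sum>w\<in>weyl_group. smul (hecke_q ^ affine_length w) (weighted_sum X * T w))"
    unfolding weighted_sum_def [of weyl_group] by (simp add: sum_distrib_left smul_mult_right coeff_intros)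
  also have "\<dots> = (\<Sum>w\<in>weyl_group. smul ((hecke_q ^ 2) ^ weyl_length w) (weighted_sum X))"
    by (intro sum.cong refl)
      (simp add: weighted_sum_right [OF X closed] smul_smul [symmetric] coeff_intros weyl_length_eq
        power2_eq_square power_mult_distrib)
  also have "\<dots> = smul (poincare 0 (hecke_q ^ 2)) (weighted_sum X)"
    by (simp add: poincare_def stabilizer_0 smul_sum_left coeff_intros)
  finally show ?thesis .
qed

lemma one0_eq: "one0 = smul (inverse (poincare 0 (hecke_q ^ 2))) (weighted_sum weyl_group)"
  by (simp add: one0_def weighted_sum_def weyl_length_eq inverse_eq_divide)

section \<open>The product of \<open>S\<close> and \<open>E\<close>, and the formula for
  \<open>M_elem\<close>\<close>

text \<open>The length of \<open>translation lam \<circ> v\<close> is that of the translation minus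
  that of \<open>v\<close>, so \<open>T (translation lam)\<close> factors as
  \<open>T (translation lam \<circ> v) * T (inv v)\<close>, and \<open>T (inv v)\<close> acts on
  \<open>E\<close> as a power of \<open>hecke_q\<close>.\<close>

lemma sandwich_min_rep:
  assumes lam: "lam \<in> dominant_weights" and v: "v \<in> min_reps lam"
  defines "E \<equiv> weighted_sum weyl_group"
  shows "E * T (translation lam \<circ> v) * E
    = smul (inverse hecke_q ^ affine_length v) (E * T (translation lam) * E)"
proof -
  have vW: "v \<in> weyl_group" using min_reps_weyl [OF v] .
  have tv: "translation lam \<circ> v \<in> ext_affine_weyl_group"
    using affine_comp [OF translation_affine weyl_affine] dominant_weight [OF lam] vW by blast
  have cancel: "(translation lam \<circ> v) \<circ> inv v = translation lam"
    by (simp add: fun_eq_iff weyl_f_inv [OF vW])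
  have "affine_length (translation lam) = affine_length (translation lam \<circ> v) + affine_length (inv v)"
    using length_double_coset [OF lam weyl_id v] length_weyl_inv [OF vW] by simp
  then have "T (translation lam) = T (translation lam \<circ> v) * T (inv v)"
    using T_mult [OF tv weyl_affine [OF weyl_inv [OF vW]]] by (simp only: cancel)
  moreover have "T (inv v) * E = smul (hecke_q ^ affine_length v) E"
    unfolding E_def length_weyl_inv [OF vW, symmetric]
    by (rule weighted_sum_left) (auto simp: weyl_affine weyl_comp weyl_inv [OF vW])
  ultimately have "E * T (translation lam) * E
      = smul (hecke_q ^ affine_length v) (E * T (translation lam \<circ> v) * E)"
    by (simp add: mult.assoc smul_mult_right coeff_intros)
  then show ?thesis
    by (simp add: smul_smul [symmetric] coeff_intros power_mult_distrib [symmetric] smul_one)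
qed

text \<open>Comparing \<open>length_double_coset\<close> for \<open>u\<close> and for
  \<open>id\<close> shows that the lengths of \<open>u\<close> and
  \<open>translation lam \<circ> v\<close> add. Each summand therefore factors, and summing over
  \<open>u\<close> collects \<open>E\<close>.\<close>

lemma weighted_sum_double_coset:
  assumes lam: "lam \<in> dominant_weights"
  shows "weighted_sum (double_coset lam) = (\<Sum>v\<in>min_reps lam.
    smul (hecke_q ^ affine_length (translation lam \<circ> v))
      (weighted_sum weyl_group * T (translation lam \<circ> v)))"
proof -
  let ?t = "translation lam" and ?l = affine_length
  have split: "smul (hecke_q ^ ?l (u \<circ> ?t \<circ> v)) (T (u \<circ> ?t \<circ> v))
      = smul (hecke_q ^ ?l (?t \<circ> v)) (smul (hecke_q ^ ?l u) (T u) * T (?t \<circ> v))"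
    if u: "u \<in> weyl_group" and v: "v \<in> min_reps lam" for u v
  proof -
    have tv: "?t \<circ> v \<in> ext_affine_weyl_group"
      using affine_comp [OF translation_affine weyl_affine] dominant_weight [OF lam] min_reps_weyl [OF v]
      by blast
    have len: "?l (u \<circ> (?t \<circ> v)) = ?l u + ?l (?t \<circ> v)"
      using length_double_coset [OF lam u v] length_double_coset [OF lam weyl_id v]
      by (simp add: comp_assoc)
    have T: "T (u \<circ> (?t \<circ> v)) = T u * T (?t \<circ> v)"
      using T_mult [OF weyl_affine [OF u] tv len] by (rule sym)
    show ?thesis
      unfolding comp_assoc len T
      by (simp add: smul_mult_left smul_smul [symmetric] coeff_intros power_add mult.commute)
  qed
  have "weighted_sum (double_coset lam)
    = (\<Sum>(u, v)\<in>weyl_group \<times> min_reps lam. smul (hecke_q ^ ?l (u \<circ> ?t \<circ> v)) (T (u \<circ> ?t \<circ> v)))"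
    unfolding weighted_sum_def
    using sum.reindex_bij_betw [OF bij_betw_double_coset [OF lam],
        of "\<lambda>x. smul (hecke_q ^ ?l x) (T x)"]
    by (simp add: case_prod_unfold)
  also have "\<dots> = (\<Sum>(u, v)\<in>weyl_group \<times> min_reps lam.
      smul (hecke_q ^ ?l (?t \<circ> v)) (smul (hecke_q ^ ?l u) (T u) * T (?t \<circ> v)))"
    using split by (intro sum.cong) auto
  also have "\<dots> = (\<Sum>u\<in>weyl_group. \<Sum>v\<in>min_reps lam.
      smul (hecke_q ^ ?l (?t \<circ> v)) (smul (hecke_q ^ ?l u) (T u) * T (?t \<circ> v)))"
    by (rule sum.cartesian_product [symmetric])
  also have "\<dots> = (\<Sum>v\<in>min_reps lam. \<Sum>u\<in>weyl_group.
      smul (hecke_q ^ ?l (?t \<circ> v)) (smul (hecke_q ^ ?l u) (T u) * T (?t \<circ> v)))"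
    by (rule sum.swap)
  finally show ?thesis
    by (simp add: weighted_sum_def sum_distrib_right smul_sum_right coeff_intros)
qed

lemma weighted_sum_double_coset_eq_M:
  assumes lam: "lam \<in> dominant_weights"
  shows "weighted_sum (double_coset lam)
    = smul (hecke_q ^ affine_length (translation lam) * poincare 0 (hecke_q ^ 2)
        * (\<Sum>v\<in>min_reps lam. (hecke_q powi (-2)) ^ weyl_length v)) (M_elem lam)"
proof -
  let ?t = "translation lam" and ?l = affine_length and ?E = "weighted_sum weyl_group"
  let ?P = "poincare 0 (hecke_q ^ 2)" and ?D = "\<Sum>v\<in>min_reps lam. (hecke_q powi (-2)) ^ weyl_length v"
  let ?S = "weighted_sum (double_coset lam)"
  have coeffs: "?P \<in> coeff_ring" "?D \<in> coeff_ring"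
    by (intro coeff_intros)+
  \<comment> \<open>\<open>M_elem\<close> carries one inverse of \<open>W_0(q^2)\<close> from each
    \<open>one0\<close>. One cancels the explicit factor in the coefficient, the other the factor
    produced by multiplying \<open>S\<close> by \<open>E\<close>.\<close>
  have cancel: "a * p * d * (inverse p * inverse p) = inverse p * (a * d)"
    if "p \<noteq> 0" for a p d :: "int poly fract"
    using that by (simp add: field_simps)
  have "?S * ?E = (\<Sum>v\<in>min_reps lam. smul (hecke_q ^ ?l (?t \<circ> v)) (?E * T (?t \<circ> v) * ?E))"
    by (simp add: weighted_sum_double_coset [OF lam] sum_distrib_right smul_mult_left coeff_intros)
  also have "\<dots> = (\<Sum>v\<in>min_reps lam. smul (hecke_q ^ ?l ?t * (hecke_q powi (-2)) ^ weyl_length v)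
      (?E * T ?t * ?E))"
  proof (rule sum.cong [OF refl])
    fix v assume v: "v \<in> min_reps lam"
    have "?l ?t = ?l (?t \<circ> v) + ?l v" using length_double_coset [OF lam weyl_id v] by simp
    then have "hecke_q ^ ?l (?t \<circ> v) * inverse hecke_q ^ ?l v
        = hecke_q ^ ?l ?t * (hecke_q powi (-2)) ^ weyl_length v"
      unfolding hecke_q_powi_minus2 weyl_length_eq [OF min_reps_weyl [OF v]]
      by (simp add: power_add mult_2 field_simps)
    then show "smul (hecke_q ^ ?l (?t \<circ> v)) (?E * T (?t \<circ> v) * ?E)
        = smul (hecke_q ^ ?l ?t * (hecke_q powi (-2)) ^ weyl_length v) (?E * T ?t * ?E)"
      by (simp add: sandwich_min_rep [OF lam v] smul_smul [symmetric] coeff_intros)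
  qed
  also have "\<dots> = smul (hecke_q ^ ?l ?t * ?D) (?E * T ?t * ?E)"
    unfolding sum_distrib_left by (simp add: smul_sum_left coeff_intros)
  finally have SE: "smul ?P ?S = smul (hecke_q ^ ?l ?t * ?D) (?E * T ?t * ?E)"
    using weighted_sum_mult_weyl [OF double_coset_affine [OF dominant_weight [OF lam]] double_coset_right]
    by simp
  have "M_elem lam = smul (inverse ?P * inverse ?P) (?E * T ?t * ?E)"
    by (simp add: M_elem_def x_elem_dominant [OF lam] one0_eq smul_mult_left smul_mult_right
        smul_smul coeff_intros mult.assoc)
  then have "smul (hecke_q ^ ?l ?t * ?P * ?D) (M_elem lam)
      = smul (hecke_q ^ ?l ?t * ?P * ?D * (inverse ?P * inverse ?P)) (?E * T ?t * ?E)"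
    by (simp add: smul_smul [symmetric] coeff_intros coeffs)
  also have "hecke_q ^ ?l ?t * ?P * ?D * (inverse ?P * inverse ?P) = inverse ?P * (hecke_q ^ ?l ?t * ?D)"
    by (rule cancel [OF poincare_q2_nonzero])
  also have "smul \<dots> (?E * T ?t * ?E) = smul (inverse ?P) (smul ?P ?S)"
    by (simp add: SE smul_smul coeff_intros coeffs)
  also have "\<dots> = ?S"
    using poincare_q2_nonzero by (simp add: smul_smul [symmetric] coeff_intros coeffs smul_one)
  finally show ?thesis by (rule sym)
qed

lemma M_elem_double_coset:
  assumes lam: "lam \<in> dominant_weights"
  shows "smul (hecke_q powi (- int (weyl_length longest_element)) * poincare 0 (hecke_q ^ 2)
        * (poincare 0 (hecke_q powi (-2)) / poincare lam (hecke_q powi (-2)))) (M_elem lam)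
    = (\<Sum>x\<in>double_coset lam.
        smul (hecke_q powi (int (affine_length x) - int (affine_length (max_length_element lam)))) (T x))"
proof -
  let ?t = "translation lam" and ?l = affine_length
  let ?P = "poincare 0 (hecke_q ^ 2)" and ?D = "\<Sum>v\<in>min_reps lam. (hecke_q powi (-2)) ^ weyl_length v"
  let ?k = "- int (?l (max_length_element lam))"
  \<comment> \<open>The laws of \<open>smul\<close> require scalars in \<open>coeff_ring\<close>;
    membership of the quotient is visible only in the form \<open>?D\<close>.\<close>
  have D: "poincare 0 (hecke_q powi (-2)) / poincare lam (hecke_q powi (-2)) = ?D"
    unfolding poincare_min_reps [OF lam, of "hecke_q powi (-2)"]
    by (rule nonzero_mult_div_cancel_left [OF poincare_q_minus2_nonzero])
  have coeffs: "?P \<in> coeff_ring" "?D \<in> coeff_ring" by (intro coeff_intros)+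
  have k: "hecke_q powi (int n - int (?l (max_length_element lam))) = hecke_q powi ?k * hecke_q ^ n" for n
    by (simp add: power_int_diff power_int_minus divide_inverse mult.commute)
  have "(\<Sum>x\<in>double_coset lam. smul (hecke_q powi (int (?l x) - int (?l (max_length_element lam)))) (T x))
      = smul (hecke_q powi ?k) (weighted_sum (double_coset lam))"
    using k by (simp add: weighted_sum_def smul_sum_right coeff_intros smul_smul [symmetric])
  also have "\<dots> = smul (hecke_q powi ?k * (hecke_q ^ ?l ?t * ?P * ?D)) (M_elem lam)"
    by (simp add: weighted_sum_double_coset_eq_M [OF lam] smul_smul [symmetric] coeff_intros coeffs)
  \<comment> \<open>The maximal length is that of the longest element plus that of the translation,
    so the power of the translation length cancels.\<close>
  also have "hecke_q powi ?k * (hecke_q ^ ?l ?t * ?P * ?D)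
      = hecke_q powi (- int (weyl_length longest_element)) * ?P * ?D"
    using k [of "?l ?t"] by (simp add: length_max_element [OF lam] mult.assoc)
  finally show ?thesis by (simp only: D)
qed

end

theorem lemma2p18:
  fixes B :: "'a::euclidean_space \<Rightarrow> 'a \<Rightarrow> real"
    and R Rp :: "'a set"
    and \<phi> lam :: 'a
    and smul :: "int poly fract \<Rightarrow> 'h::ring_1 \<Rightarrow> 'h"
    and T :: "('a \<Rightarrow> 'a) \<Rightarrow> 'h"
  assumes "affine_hecke_algebra B R Rp \<phi> smul T"
    and "lam \<in> positive_root_system.dominant_weights B R Rp"
  shows "smul
      (hecke_q powi (- int (positive_root_system.weyl_length B Rp
                              (positive_root_system.longest_element B R Rp)))
        * positive_root_system.poincare B R Rp 0 (hecke_q ^ 2)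
        * (positive_root_system.poincare B R Rp 0 (hecke_q powi (-2))
            / positive_root_system.poincare B R Rp lam (hecke_q powi (-2))))
      (affine_hecke_algebra.M_elem B R Rp smul T lam)
    = (\<Sum>x\<in>root_system.double_coset B R lam.
        smul (hecke_q powi
               (int (positive_root_system.affine_length B Rp x)
                - int (positive_root_system.affine_length B Rp
                         (positive_root_system.max_length_element B R Rp lam))))
          (T x))"
proof -
  interpret affine_hecke_algebra B R Rp \<phi> smul T by (rule assms(1))
  show ?thesis by (rule M_elem_double_coset [OF assms(2)])
qed

end
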